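(* There is an absolute constant $C>0$ such that the following holds. Let $\mathbf{A}\in\mathbb{R}^{m\times n}$ be a full-column-rank matrix whose rows are partitioned into $k$ nonzero blocks $\mathbf{A}_{[1]},\ldots,\mathbf{A}_{[k]}$ with $\mathbf{A}_{[i]}\in\mathbb{R}^{m_i\times n}$ for each $i\in[k]$. Let $p>2$, let $\overline{\mathbf{w}}\in\mathbb{R}^k_{>0}$ denote the $\ell_p$ block Lewis weights of $\mathbf{A}$, and let $\varepsilon\in(0,1)$. Then there is an algorithm (the fixed-point iteration algorithm described in the context) which returns $\widehat{\mathbf{w}}\in\mathbb{R}^k_{>0}$ satisfying $$(1-\varepsilon)\overline{w}_i\le \widehat{w}_i\le(1+\varepsilon)\overline{w}_i\qquad\text{for every } i\in[k],$$ using at most $$C\,p\log\left(\frac{p\sqrt{\sum_{i=1}^k\operatorname{rank}(\mathbf{A}_{[i]})}}{\varepsilon}\right)$$ iterations, where each iteration computes all $m$ exact row leverage scores of a matrix $\mathbf{D}\mathbf{A}$ with $\mathbf{D}=\operatorname{Diag}(d_1\mathbf{I}_{m_1},\ldots,d_k\mathbf{I}_{m_k})$ for some positive $d_1,\ldots,d_k$.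
   Context: All computations are in exact real arithmetic. Leverage scores. For a full-column-rank matrix $\mathbf{B}$ with rows $\mathbf{b}_j^\top$, the $j$-th leverage score is $\sigma_j(\mathbf{B}):=\mathbf{b}_j^\top(\mathbf{B}^\top\mathbf{B})^{-1}\mathbf{b}_j$. If the rows of $\mathbf{B}$ are partitioned into blocks $\mathbf{B}_{[1]},\ldots,\mathbf{B}_{[k]}$, the $i$-th block leverage score is $\sigma_{[i]}(\mathbf{B}):=\operatorname{Tr}(\mathbf{B}_{[i]}(\mathbf{B}^\top\mathbf{B})^{-1}\mathbf{B}_{[i]}^\top)$, i.e. the sum of the leverage scores of the rows in block $i$. Block Lewis weights. For a block weight vector $\mathbf{w}\in\mathbb{R}^k_{>0}$ write $\mathbf{W}:=\operatorname{Diag}(w_1\mathbf{I}_{m_1},\ldots,w_k\mathbf{I}_{m_k})$. For $p>2$, the $\ell_p$ block Lewis weights of $\mathbf{A}$ are the unique vector $\overline{\mathbf{w}}\in\mathbb{R}^k_{>0}$ satisfying $\overline{w}_i=\sigma_{[i]}(\overline{\mathbf{W}}^{1/2-1/p}\mathbf{A})$ for all $i\in[k]$ (existence and uniqueness are known). The algorithm (input: $\mathbf{A}$ with its block partition, $p>2$, $\varepsilon\in(0,1)$). Compute $r_i:=\operatorname{rank}(\mathbf{A}_{[i]})$ and $R:=\sum_{i=1}^k r_i$. If $R=n$, return $\widehat{w}_i=r_i$ for all $i$ (no iterations are performed). Otherwise set $w_i^{(0)}:=nr_i/R$ for all $i$ and $N:=\lceil p\log(8p\sqrt{R}/\varepsilon)\rceil$.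 For $t=0,1,\ldots,N-1$ (one iteration each), compute the exact row leverage scores of $(\mathbf{W}^{(t)})^{1/2-1/p}\mathbf{A}$ and set $w_i^{(t+1)}:=\sigma_{[i]}((\mathbf{W}^{(t)})^{1/2-1/p}\mathbf{A})$ for all $i\in[k]$. Return $$\widehat{w}_i:=\left(\frac{w_i^{(N)}}{(w_i^{(N-1)})^{1-2/p}}\right)^{p/2}\quad\text{for all } i\in[k].$$ *)

theory Defs
  imports
    Complex_Main
    "Jordan_Normal_Form.Gauss_Jordan_Elimination"
    "Jordan_Normal_Form.DL_Rank"
    "Jordan_Normal_Form.DL_Submatrix"
begin

text \<open>
  A partition of the rows of \<open>A\<close> into \<open>k\<close> blocks is given by a map \<open>blk\<close> sending each row index
  \<open>j < dim_row A\<close> to its block index \<open>blk j < k\<close>; the rows of a block need not be contiguous.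
  Blocks, rows and columns are indexed from 0.  Block weight vectors in \<open>\<real>\<^sup>k\<close> are functions on
  \<open>nat\<close>, of which only the values at \<open>i < k\<close> matter.
\<close>

definition mat_rank :: "real mat \<Rightarrow> nat" where
  "mat_rank A = vec_space.rank (dim_row A) A"

definition mat_trace :: "real mat \<Rightarrow> real" where
  "mat_trace A = (\<Sum>i<dim_row A. A $$ (i, i))"

text \<open>Meaningful only if \<open>B\<close> has full column rank, so that the Gram matrix is invertible.\<close>

definition gram_inverse :: "real mat \<Rightarrow> real mat" where
  "gram_inverse B = the (mat_inverse (transpose_mat B * B))"

definition row_block :: "real mat \<Rightarrow> (nat \<Rightarrow> nat) \<Rightarrow> nat \<Rightarrow> real mat" where
  "row_block A blk i = submatrix A {j. j < dim_row A \<and> blk j = i} UNIV"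

definition leverage_score :: "real mat \<Rightarrow> nat \<Rightarrow> real" where
  "leverage_score B j = row B j \<bullet> (gram_inverse B *\<^sub>v row B j)"

definition block_leverage_score :: "real mat \<Rightarrow> (nat \<Rightarrow> nat) \<Rightarrow> nat \<Rightarrow> real" where
  "block_leverage_score B blk i =
     mat_trace (row_block B blk i * gram_inverse B * transpose_mat (row_block B blk i))"

text \<open>\<open>D A\<close> with \<open>D = Diag(d\<^sub>1 I, \<dots>, d\<^sub>k I)\<close>.\<close>

definition block_scale :: "(nat \<Rightarrow> nat) \<Rightarrow> (nat \<Rightarrow> real) \<Rightarrow> real mat \<Rightarrow> real mat" where
  "block_scale blk d A = mat_diag (dim_row A) (\<lambda>j. d (blk j)) * A"

definition lewis_scaling :: "real \<Rightarrow> (nat \<Rightarrow> real) \<Rightarrow> nat \<Rightarrow> real" where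
  "lewis_scaling p w i = w i powr (1/2 - 1/p)"

definition is_block_lewis_weights ::
    "real mat \<Rightarrow> (nat \<Rightarrow> nat) \<Rightarrow> nat \<Rightarrow> real \<Rightarrow> (nat \<Rightarrow> real) \<Rightarrow> bool" where
  "is_block_lewis_weights A blk k p w \<longleftrightarrow>
     (\<forall>i<k. 0 < w i) \<and>
     (\<forall>i<k. w i = block_leverage_score (block_scale blk (lewis_scaling p w) A) blk i)"

text \<open>
  The state of the fixed-point iteration is \<open>(w\<^sup>(\<^sup>t\<^sup>-\<^sup>1\<^sup>), w\<^sup>(\<^sup>t\<^sup>), hist)\<close>.  Each iteration appends to the history
  the scaling \<open>d\<close> it used together with the row leverage scores it computed for \<open>D A\<close>.  The next
  weights are obtained from these scores only, by summing over the rows of each block; the lemma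
  \<open>block_leverage_score_eq_sum\<close> below shows that these sums are the block leverage scores.
\<close>

type_synonym lewis_history = "((nat \<Rightarrow> real) \<times> (nat \<Rightarrow> real)) list"

definition lewis_step ::
    "real mat \<Rightarrow> (nat \<Rightarrow> nat) \<Rightarrow> real \<Rightarrow>
     (nat \<Rightarrow> real) \<times> (nat \<Rightarrow> real) \<times> lewis_history \<Rightarrow> (nat \<Rightarrow> real) \<times> (nat \<Rightarrow> real) \<times> lewis_history" where
  "lewis_step A blk p = (\<lambda>(w_prev, w, hist).
     let d = lewis_scaling p w;
         s = leverage_score (block_scale blk d A)
     in (w, \<lambda>i. \<Sum>j | j < dim_row A \<and> blk j = i. s j, hist @ [(d, s)]))"

definition block_rank_sum :: "real mat \<Rightarrow> (nat \<Rightarrow> nat) \<Rightarrow> nat \<Rightarrow> nat" where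
  "block_rank_sum A blk k = (\<Sum>i<k. mat_rank (row_block A blk i))"

definition lewis_num_iterations :: "real \<Rightarrow> real \<Rightarrow> nat \<Rightarrow> nat" where
  "lewis_num_iterations p \<epsilon> R = nat \<lceil>p * ln (8 * p * sqrt (real R) / \<epsilon>)\<rceil>"

text \<open>
  The result is the returned weight vector together with the history.  The first component of the
  initial state is a dummy value, which is overwritten by the first iteration (for \<open>p > 2\<close>,
  \<open>0 < \<epsilon> < 1\<close> and \<open>R \<ge> 1\<close> there is at least one).
\<close>

definition block_lewis_algorithm ::
    "real mat \<Rightarrow> (nat \<Rightarrow> nat) \<Rightarrow> nat \<Rightarrow> real \<Rightarrow> real \<Rightarrow> (nat \<Rightarrow> real) \<times> lewis_history" where
  "block_lewis_algorithm A blk k p \<epsilon> =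
     (let n = dim_col A;
          r = (\<lambda>i. mat_rank (row_block A blk i));
          R = block_rank_sum A blk k
      in if R = n then (\<lambda>i. real (r i), [])
         else
           let w0 = (\<lambda>i. real n * real (r i) / real R);
               N = lewis_num_iterations p \<epsilon> R;
               (w_prev, w, hist) = (lewis_step A blk p ^^ N) (w0, w0, [])
           in (\<lambda>i. (w i / w_prev i powr (1 - 2/p)) powr (p/2), hist))"

lemma block_leverage_score_eq_sum:
  assumes B: "B \<in> carrier_mat m n" and X: "gram_inverse B \<in> carrier_mat n n"
  shows "block_leverage_score B blk i = (\<Sum>j | j < m \<and> blk j = i. leverage_score B j)"
proof -
  define J where "J = {j. j < m \<and> blk j = i}"
  define M where "M = row_block B blk i"
  have dr: "dim_row B = m" and dc: "dim_col B = n" using B by auto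
  have finJ: "finite J" unfolding J_def by simp
  have card_eq: "card {a. a < dim_row B \<and> a \<in> J} = card J"
    unfolding J_def dr by (rule arg_cong[where f = card]) auto
  have Mdef: "M = submatrix B J UNIV" unfolding M_def row_block_def J_def dr ..
  have M: "M \<in> carrier_mat (card J) n"
    unfolding Mdef by (rule carrier_matI) (simp_all add: dim_submatrix card_eq dc)
  have pickJ: "pick J a \<in> J" if "a < card J" for a
    using that by (intro pick_in_set_le)
  have rowM: "row M a = row B (pick J a)" if a: "a < card J" for a
  proof (rule eq_vecI)
    show "dim_vec (row M a) = dim_vec (row B (pick J a))" using M dc by auto
    fix b assume "b < dim_vec (row B (pick J a))"
    then have b: "b < n" using dc by simp
    have "M $$ (a, b) = B $$ (pick J a, pick UNIV b)"
      unfolding Mdef by (rule submatrix_index) (use a b in \<open>simp_all add: card_eq dc\<close>)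
    then show "row M a $ b = row B (pick J a) $ b"
      using a b M dr dc pickJ[OF a] by (auto simp: pick_UNIV J_def)
  qed
  have entry: "(M * gram_inverse B * transpose_mat M) $$ (a, a) = leverage_score B (pick J a)"
    if a: "a < card J" for a
  proof -
    have "M * gram_inverse B * transpose_mat M = M * (gram_inverse B * transpose_mat M)"
      using M X by (intro assoc_mult_mat[of _ "card J" n _ n _ "card J"]) auto
    then have "(M * gram_inverse B * transpose_mat M) $$ (a, a)
        = row M a \<bullet> col (gram_inverse B * transpose_mat M) a"
      using a M X by simp
    also have "col (gram_inverse B * transpose_mat M) a = gram_inverse B *\<^sub>v row M a"
      using a M X by (subst col_mult2[of _ n n _ "card J"]) auto
    finally show ?thesis unfolding leverage_score_def rowM[OF a] .
  qed
  have inj: "inj_on (pick J) {..<card J}"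
    by (rule inj_onI) (metis lessThan_iff nat_neq_iff pick_mono_le)
  have bij: "bij_betw (pick J) {..<card J} J"
    unfolding bij_betw_def using inj pickJ finJ
    by (metis card_image card_lessThan card_subset_eq image_subsetI lessThan_iff)
  have "block_leverage_score B blk i = (\<Sum>a<card J. leverage_score B (pick J a))"
    unfolding block_leverage_score_def mat_trace_def M_def[symmetric]
    using M entry by (intro sum.cong) auto
  also have "\<dots> = (\<Sum>j\<in>J. leverage_score B j)"
    by (rule sum.reindex_bij_betw[OF bij])
  finally show ?thesis unfolding J_def .
qed

end

theory Submission
  imports Defs
begin

text \<open>
  Write \<open>b = 1 - 2/p\<close>, \<open>M(w) = \<Sum>\<^sub>i w\<^sub>i\<^sup>b A\<^sub>i\<^sup>T A\<^sub>i\<close> for the blocks \<open>A\<^sub>i\<close>, and \<open>s\<^sub>i(w) = Tr(A\<^sub>i M(w)\<^sup>-\<^sup>1 A\<^sub>i\<^sup>T)\<close>, so that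
  an iteration is \<open>w\<^sub>i \<mapsto> w\<^sub>i\<^sup>b s\<^sub>i(w)\<close> and the Lewis weights \<open>v\<close> are its fixed point.  The relative
  entropy \<open>KL(v, w) = \<Sum>\<^sub>i v\<^sub>i ln(v\<^sub>i/w\<^sub>i)\<close> contracts by the factor \<open>b\<close> in every iteration: the new
  value is \<open>b KL(v, w) - \<Sum>\<^sub>i v\<^sub>i ln(s\<^sub>i(w)/s\<^sub>i(v))\<close>, and the last sum is nonnegative, since
  Cauchy-Schwarz gives \<open>s\<^sub>i(w)/s\<^sub>i(v) \<ge> s\<^sub>i(v)/c\<^sub>i\<close> with \<open>c\<^sub>i = Tr(A\<^sub>i M(v)\<^sup>-\<^sup>1 M(w) M(v)\<^sup>-\<^sup>1 A\<^sub>i\<^sup>T)\<close>, whence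
  \<open>\<Sum>\<^sub>i v\<^sub>i ln(s\<^sub>i(w)/s\<^sub>i(v)) \<ge> n - Tr(M(v)\<^sup>-\<^sup>1 M(w)) = n - \<Sum>\<^sub>i w\<^sub>i\<^sup>b v\<^sub>i\<^bsup>1-b\<^esup> \<ge> 0\<close>
  by \<open>ln x \<ge> 1 - 1/x\<close> and the weighted AM-GM inequality.  Initially the entropy is at most \<open>R\<close>, because a
  block leverage score is at most the rank of the block.  Finally the entropy dominates the squared
  Hellinger distance, and together with \<open>\<bar>A\<^sub>i x\<bar>\<^sup>2 \<le> s\<^sub>i(v) x\<^sup>T M(v) x\<close> this makes \<open>M(w)\<close> a spectral
  approximation of \<open>M(v)\<close> with relative error \<open>\<epsilon>/(2p)\<close>; the power \<open>p/2\<close> in the output turns the resulting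
  bound on \<open>s\<^sub>i(w)\<close> into the relative error \<open>\<epsilon>\<close>.
\<close>

section \<open>Inverse Gram matrices and rank\<close>

text \<open>\<open>dual\<close> says that \<open>P\<close> is the inverse of G = sum of
  \<open>g l\<close> times a_l a_l^T, as an identity of bilinear forms: G is never built as a
  matrix, and a scaling of the rows can be moved into the weights. \<open>energy\<close> is the
  quadratic form of G.\<close>

locale gram_dual =
  fixes a :: "nat \<Rightarrow> real vec" and g :: "nat \<Rightarrow> real" and m n :: nat and P :: "real mat"
  assumes rows: "l < m \<Longrightarrow> a l \<in> carrier_vec n"
    and weights_nonneg: "l < m \<Longrightarrow> 0 \<le> g l"
    and P: "P \<in> carrier_mat n n"
    and dual: "x \<in> carrier_vec n \<Longrightarrow> y \<in> carrier_vec n \<Longrightarrow>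
      (\<Sum>l<m. g l * (a l \<bullet> x) * (a l \<bullet> (P *\<^sub>v y))) = x \<bullet> y"
begin

definition energy :: "real vec \<Rightarrow> real" where
  "energy x = (\<Sum>l<m. g l * (a l \<bullet> x)\<^sup>2)"

lemma P_vec: "y \<in> carrier_vec n \<Longrightarrow> P *\<^sub>v y \<in> carrier_vec n"
  using P by (rule mult_mat_vec_carrier)

lemma energy_nonneg: "0 \<le> energy x"
  unfolding energy_def by (intro sum_nonneg mult_nonneg_nonneg) (auto intro: weights_nonneg)

text \<open>Both sides are the G-inner product of P x and P y.\<close>

lemma symmetric:
  assumes "x \<in> carrier_vec n" "y \<in> carrier_vec n"
  shows "x \<bullet> (P *\<^sub>v y) = y \<bullet> (P *\<^sub>v x)"
proof -
  have "x \<bullet> (P *\<^sub>v y) = (P *\<^sub>v y) \<bullet> x"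
    using assms P_vec by (intro comm_scalar_prod) auto
  also have "\<dots> = (\<Sum>l<m. g l * (a l \<bullet> (P *\<^sub>v y)) * (a l \<bullet> (P *\<^sub>v x)))"
    using assms P_vec by (simp add: dual)
  also have "\<dots> = (\<Sum>l<m. g l * (a l \<bullet> (P *\<^sub>v x)) * (a l \<bullet> (P *\<^sub>v y)))"
    by (simp add: mult_ac)
  also have "\<dots> = (P *\<^sub>v x) \<bullet> y"
    using assms P_vec by (simp add: dual)
  also have "\<dots> = y \<bullet> (P *\<^sub>v x)"
    using assms P_vec by (intro comm_scalar_prod) auto
  finally show ?thesis .
qed

lemma energy_P:
  assumes "y \<in> carrier_vec n"
  shows "energy (P *\<^sub>v y) = y \<bullet> (P *\<^sub>v y)"
proof -
  have "energy (P *\<^sub>v y) = (P *\<^sub>v y) \<bullet> y"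
    using dual[of "P *\<^sub>v y" y] assms P_vec by (simp add: energy_def power2_eq_square mult_ac)
  then show ?thesis
    using assms P_vec by (simp add: comm_scalar_prod[of _ n])
qed

text \<open>The energy of P y - t x is nonnegative. This bounds y^T P y from below by expressions
  free of P, so that a choice of test vectors replaces arguments about the order of inverse
  matrices.\<close>

lemma variational:
  assumes x: "x \<in> carrier_vec n" and y: "y \<in> carrier_vec n"
  shows "2 * t * (x \<bullet> y) - t\<^sup>2 * energy x \<le> y \<bullet> (P *\<^sub>v y)"
proof -
  have "0 \<le> (\<Sum>l<m. g l * (a l \<bullet> (P *\<^sub>v y) - t * (a l \<bullet> x))\<^sup>2)"
    by (intro sum_nonneg mult_nonneg_nonneg) (auto intro: weights_nonneg)
  also have "\<dots> = energy (P *\<^sub>v y) - 2 * t * (\<Sum>l<m. g l * (a l \<bullet> x) * (a l \<bullet> (P *\<^sub>v y)))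
      + t\<^sup>2 * energy x"
    unfolding energy_def sum_distrib_left sum_subtractf[symmetric] sum.distrib[symmetric]
    by (intro sum.cong) (auto simp: power2_eq_square algebra_simps)
  finally show ?thesis
    using x y by (simp add: dual energy_P)
qed

lemma cauchy_schwarz:
  assumes x: "x \<in> carrier_vec n" and y: "y \<in> carrier_vec n"
  shows "(x \<bullet> y)\<^sup>2 \<le> energy x * (y \<bullet> (P *\<^sub>v y))"
proof (cases "energy x = 0")
  case True
  have "x \<bullet> y = 0"
  proof (rule ccontr)
    assume "x \<bullet> y \<noteq> 0"
    \<comment> \<open>With no quadratic term the bound is linear in t, and this t makes its left
      side y^T P y + 1.\<close>
    then show False
      using variational[OF x y, of "(y \<bullet> (P *\<^sub>v y) + 1) / (2 * (x \<bullet> y))"] True by simp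
  qed
  then show ?thesis using True by simp
next
  case False
  then have e: "energy x > 0" using energy_nonneg[of x] by simp
  have "(x \<bullet> y)\<^sup>2 / energy x \<le> y \<bullet> (P *\<^sub>v y)"
    using variational[OF x y, of "(x \<bullet> y) / energy x"] e
    by (simp add: power2_eq_square field_simps)
  then show ?thesis using e by (simp add: field_simps)
qed

text \<open>The sum is Tr(G P), evaluated on the unit vectors.\<close>

lemma trace: "(\<Sum>l<m. g l * (a l \<bullet> (P *\<^sub>v a l))) = real n"
proof -
  have coord: "x \<bullet> unit_vec n c = x $ c" if "c < n" "x \<in> carrier_vec n" for x :: "real vec" and c
    using that by simp
  have Pcoord: "a l \<bullet> (P *\<^sub>v unit_vec n c) = (P *\<^sub>v a l) $ c" if "c < n" "l < m" for l c
  proof -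
    have "a l \<bullet> (P *\<^sub>v unit_vec n c) = unit_vec n c \<bullet> (P *\<^sub>v a l)"
      by (rule symmetric) (use that rows in auto)
    also have "\<dots> = (P *\<^sub>v a l) $ c" using that rows P_vec[of "a l"] by simp
    finally show ?thesis .
  qed
  have "(\<Sum>l<m. g l * (a l \<bullet> (P *\<^sub>v a l)))
      = (\<Sum>l<m. \<Sum>c<n. g l * (a l \<bullet> unit_vec n c) * (a l \<bullet> (P *\<^sub>v unit_vec n c)))"
  proof (rule sum.cong[OF refl])
    fix l assume "l \<in> {..<m}"
    then have l: "l < m" by simp
    have "a l \<bullet> (P *\<^sub>v a l) = (\<Sum>c<n. a l $ c * (P *\<^sub>v a l) $ c)"
      using P by (simp add: scalar_prod_def lessThan_atLeast0)
    then show "g l * (a l \<bullet> (P *\<^sub>v a l))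
        = (\<Sum>c<n. g l * (a l \<bullet> unit_vec n c) * (a l \<bullet> (P *\<^sub>v unit_vec n c)))"
      using l rows by (simp add: Pcoord coord sum_distrib_left mult_ac)
  qed
  also have "\<dots> = (\<Sum>c<n. unit_vec n c \<bullet> unit_vec n c)"
    by (subst sum.swap, rule sum.cong[OF refl], rule dual) auto
  also have "\<dots> = real n" by simp
  finally show ?thesis .
qed

text \<open>
  With \<open>q\<close> a row of the orthogonal projection onto the column space of a block, this bounds the
  leverage scores in that block by the diagonal of the projection.
\<close>

lemma leverage_le_norm_coeffs:
  assumes J: "J \<subseteq> {..<m}" and g: "\<And>l. l \<in> J \<Longrightarrow> g l = c" and c: "0 \<le> c"
    and z: "z \<in> carrier_vec n"
    and comb: "\<And>x. x \<in> carrier_vec n \<Longrightarrow> z \<bullet> x = (\<Sum>l\<in>J. q l * (a l \<bullet> x))"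
  shows "c * (z \<bullet> (P *\<^sub>v z)) \<le> (\<Sum>l\<in>J. (q l)\<^sup>2)"
proof -
  let ?e = "\<lambda>l. a l \<bullet> (P *\<^sub>v z)"
  have le: "(\<Sum>l\<in>J. c * (?e l)\<^sup>2) \<le> z \<bullet> (P *\<^sub>v z)"
  proof -
    have "(\<Sum>l\<in>J. c * (?e l)\<^sup>2) = (\<Sum>l\<in>J. g l * (?e l)\<^sup>2)"
      by (intro sum.cong) (auto simp: g)
    also have "\<dots> \<le> energy (P *\<^sub>v z)"
      unfolding energy_def by (rule sum_mono2) (use J in \<open>auto intro!: mult_nonneg_nonneg weights_nonneg\<close>)
    finally show ?thesis using energy_P[OF z] by simp
  qed
  \<comment> \<open>By \<open>comb\<close> at P z the cross term is -2c z^T P z, and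
    \<open>le\<close> bounds the last term by c z^T P z.\<close>
  have "0 \<le> (\<Sum>l\<in>J. (q l - c * ?e l)\<^sup>2)" by (rule sum_nonneg) simp
  also have "\<dots> = (\<Sum>l\<in>J. (q l)\<^sup>2) - 2 * c * (\<Sum>l\<in>J. q l * ?e l) + c * (\<Sum>l\<in>J. c * (?e l)\<^sup>2)"
    unfolding sum_distrib_left sum_subtractf[symmetric] sum.distrib[symmetric]
    by (intro sum.cong) (auto simp: power2_eq_square algebra_simps)
  also have "\<dots> \<le> (\<Sum>l\<in>J. (q l)\<^sup>2) - 2 * c * (z \<bullet> (P *\<^sub>v z)) + c * (z \<bullet> (P *\<^sub>v z))"
    using comb[OF P_vec[OF z]] mult_left_mono[OF le c] by simp
  finally show ?thesis by simp
qed

end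

text \<open>\<open>mat_inverse\<close> yields a value only for invertible matrices. B^T B is one,
  since a vector v in its kernel has |B v|^2 = v^T B^T B v = 0.\<close>

lemma gram_dual_gram_inverse:
  fixes B :: "real mat"
  assumes B: "B \<in> carrier_mat p n"
    and inj: "\<And>x. x \<in> carrier_vec n \<Longrightarrow> B *\<^sub>v x = 0\<^sub>v p \<Longrightarrow> x = 0\<^sub>v n"
  shows "gram_dual (row B) (\<lambda>_. 1) p n (gram_inverse B)"
proof -
  let ?M = "transpose_mat B * B"
  have M: "?M \<in> carrier_mat n n" using B by auto
  have form: "x \<bullet> (?M *\<^sub>v y) = (B *\<^sub>v x) \<bullet> (B *\<^sub>v y)"
    if "x \<in> carrier_vec n" "y \<in> carrier_vec n" for x y
  proof -
    have By: "B *\<^sub>v y \<in> carrier_vec p" using B that by auto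
    have "x \<bullet> (?M *\<^sub>v y) = x \<bullet> (transpose_mat B *\<^sub>v (B *\<^sub>v y))"
      using B that by (subst assoc_mult_mat_vec) auto
    also have "\<dots> = (B *\<^sub>v x) \<bullet> (B *\<^sub>v y)"
      using B that By
      by (subst comm_scalar_prod[of _ n])
        (auto simp: transpose_vec_mult_scalar[OF B] comm_scalar_prod[of _ p])
    finally show ?thesis .
  qed
  have "det ?M \<noteq> 0"
  proof
    assume "det ?M = 0"
    then obtain v where v: "v \<in> carrier_vec n" "v \<noteq> 0\<^sub>v n" "?M *\<^sub>v v = 0\<^sub>v n"
      using det_0_iff_vec_prod_zero_field[OF M] by auto
    then have "(B *\<^sub>v v) \<bullet> (B *\<^sub>v v) = 0" using form[of v v] by simp
    moreover have "B *\<^sub>v v \<in> carrier_vec p" using B v by auto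
    ultimately have "B *\<^sub>v v = 0\<^sub>v p"
      using conjugate_square_eq_0_vec[of "B *\<^sub>v v" p] by simp
    with inj v show False by auto
  qed
  then have "?M \<in> Units (ring_mat TYPE(real) n ())"
    by (rule det_non_zero_imp_unit[OF M])
  then obtain Q where Q: "mat_inverse ?M = Some Q"
    using mat_inverse(1)[OF M, where b = "()"] by (cases "mat_inverse ?M") auto
  note inv = mat_inverse(2)[OF M Q]
  have gi: "gram_inverse B = Q" unfolding gram_inverse_def Q by simp
  show ?thesis
    unfolding gi
  proof
    fix x y :: "real vec"
    assume x: "x \<in> carrier_vec n" and y: "y \<in> carrier_vec n"
    have Qy: "Q *\<^sub>v y \<in> carrier_vec n" using inv y by auto
    have "(\<Sum>l<p. 1 * (row B l \<bullet> x) * (row B l \<bullet> (Q *\<^sub>v y))) = (B *\<^sub>v x) \<bullet> (B *\<^sub>v (Q *\<^sub>v y))"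
      using B by (auto simp: scalar_prod_def[of "B *\<^sub>v x"] lessThan_atLeast0)
    also have "\<dots> = x \<bullet> (?M *\<^sub>v (Q *\<^sub>v y))" using form[OF x Qy] by simp
    also have "?M *\<^sub>v (Q *\<^sub>v y) = y"
      using inv y M by (subst assoc_mult_mat_vec[symmetric]) auto
    finally show "(\<Sum>l<p. 1 * (row B l \<bullet> x) * (row B l \<bullet> (Q *\<^sub>v y))) = x \<bullet> y" .
  qed (use B inv in auto)
qed

section \<open>Rank, injectivity and the projection onto a column space\<close>

text \<open>The chosen columns are a basis of the column space. Together they form a matrix with
  trivial kernel, to which \<open>gram_dual_gram_inverse\<close> applies.\<close>

lemma maximal_indpt_cols:
  assumes "F \<in> carrier_mat p n"
  obtains us where "distinct us" "set us \<subseteq> set (cols F)" "length us = mat_rank F"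
    "mat_of_cols p us \<in> carrier_mat p (mat_rank F)"
    "\<And>x. x \<in> carrier_vec (mat_rank F) \<Longrightarrow> mat_of_cols p us *\<^sub>v x = 0\<^sub>v p \<Longrightarrow> x = 0\<^sub>v (mat_rank F)"
    "\<And>c. c \<in> set (cols F) \<Longrightarrow> \<exists>x \<in> carrier_vec (mat_rank F). c = mat_of_cols p us *\<^sub>v x"
proof -
  interpret vec_space "TYPE(real)" p .
  have cF: "set (cols F) \<subseteq> carrier_vec p" using assms cols_dim by blast
  obtain S where S: "maximal S (\<lambda>T. T \<subseteq> set (cols F) \<and> lin_indpt T)"
    using maximal_exists_superset[of "set (cols F)" "\<lambda>T. T \<subseteq> set (cols F) \<and> lin_indpt T" "{}"]
    by (metis (no_types, lifting) List.finite_set empty_subsetI finite.emptyI lindep_span empty_iff)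
  then have SF: "S \<subseteq> set (cols F)" and Sind: "lin_indpt S" by (auto simp: maximal_def)
  have finS: "finite S" using SF finite_subset by blast
  have SC: "S \<subseteq> carrier_vec p" using SF cF by blast
  obtain us where us: "set us = S" "distinct us" using finite_distinct_list[OF finS] by blast
  have r: "mat_rank F = card S"
    using rank_card_indpt[OF assms S] assms by (simp add: mat_rank_def)
  then have len: "length us = mat_rank F" using us distinct_card by fastforce
  let ?L = "mat_of_cols p us"
  have L: "?L \<in> carrier_mat p (mat_rank F)" using len by auto
  have colsL: "cols ?L = us" using us SC by (intro cols_mat_of_cols) auto
  show ?thesis
  proof (rule that[OF us(2) _ len L])
    show "set us \<subseteq> set (cols F)" using us SF by simp
  next
    fix x assume "x \<in> carrier_vec (mat_rank F)" "?L *\<^sub>v x = 0\<^sub>v p"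
    then show "x = 0\<^sub>v (mat_rank F)"
      using lin_depI[OF L, of x] colsL us Sind by auto
  next
    fix c assume c: "c \<in> set (cols F)"
    have "c \<in> span S"
    proof (rule ccontr)
      assume nc: "c \<notin> span S"
      then have "c \<notin> S" using SC span_mem by auto
      moreover have "lin_indpt (insert c S)"
        using lin_dep_iff_in_span[of S c] nc SC Sind c cF \<open>c \<notin> S\<close> by auto
      ultimately show False
        using S c SF unfolding maximal_def by (metis insert_subset subset_insertI insertI1)
    qed
    then obtain f where "c = lincomb f S"
      using finite_in_span[OF finS, of c] SC by auto
    then have "c = ?L *\<^sub>v vec (mat_rank F) (\<lambda>i. f (col ?L i))"
      using mat_mult_eq_lincomb[OF L, of f] colsL us by simp
    then show "\<exists>x \<in> carrier_vec (mat_rank F). c = ?L *\<^sub>v x" by (metis vec_carrier)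
  qed
qed

text \<open>Linear independence speaks of the set of columns, so repeated columns are excluded
  first: they would leave too few elements for an independent set of size n.\<close>

lemma full_col_rank_inj:
  assumes A: "A \<in> carrier_mat m n" and rank: "mat_rank A = n"
    and x: "x \<in> carrier_vec n" "A *\<^sub>v x = 0\<^sub>v m"
  shows "x = 0\<^sub>v n"
proof -
  interpret vec_space "TYPE(real)" m .
  obtain us where us: "distinct us" "set us \<subseteq> set (cols A)" "length us = n"
    by (rule maximal_indpt_cols[OF A]) (auto simp: rank)
  have "card (set us) \<le> card (set (cols A))" using us by (intro card_mono) auto
  then have "distinct (cols A)"
    using us A card_distinct[of "cols A"] card_length[of "cols A"] by (simp add: distinct_card)
  moreover have "rank A = n" using rank A by (simp add: mat_rank_def)
  ultimately show ?thesis
    using full_rank_lin_indpt[OF A] lin_depI[OF A] x by blast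
qed

text \<open>\<open>H\<close> is L (L^T L)^-1 L^T, where the columns of L are a basis of the column
  space. The properties express that H fixes F, is a symmetric idempotent, and has the rank as its
  trace.\<close>

lemma col_space_projection:
  assumes F: "F \<in> carrier_mat p n"
  obtains H :: "nat \<Rightarrow> nat \<Rightarrow> real" where
    "\<And>j c. j < p \<Longrightarrow> c < n \<Longrightarrow> F $$ (j, c) = (\<Sum>l<p. H j l * F $$ (l, c))"
    "\<And>j. j < p \<Longrightarrow> (\<Sum>l<p. (H j l)\<^sup>2) = H j j"
    "(\<Sum>j<p. H j j) = real (mat_rank F)"
proof -
  let ?r = "mat_rank F"
  obtain us where
    L: "mat_of_cols p us \<in> carrier_mat p ?r" and
    inj: "\<And>x. x \<in> carrier_vec ?r \<Longrightarrow> mat_of_cols p us *\<^sub>v x = 0\<^sub>v p \<Longrightarrow> x = 0\<^sub>v ?r" and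
    sp: "\<And>c. c \<in> set (cols F) \<Longrightarrow> \<exists>x \<in> carrier_vec ?r. c = mat_of_cols p us *\<^sub>v x"
    by (rule maximal_indpt_cols[OF F]) blast
  define L where "L = mat_of_cols p us"
  define P where "P = gram_inverse L"
  interpret gram_dual "row L" "\<lambda>_. 1" p ?r P
    unfolding P_def L_def by (rule gram_dual_gram_inverse[OF L inj])
  define H where "H = (\<lambda>j l. row L l \<bullet> (P *\<^sub>v row L j))"
  have rowc: "row L l \<in> carrier_vec ?r" for l using carrier_matD(2)[OF L] by (metis L_def row_carrier)
  show ?thesis
  proof (rule that)
    fix j c assume j: "j < p" and c: "c < n"
    have "col F c \<in> set (cols F)" using F c by (auto simp: cols_def)
    then obtain x where x: "x \<in> carrier_vec ?r" "col F c = L *\<^sub>v x"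
      using sp L_def by auto
    have entry: "F $$ (l, c) = row L l \<bullet> x" if "l < p" for l
    proof -
      have "F $$ (l, c) = col F c $ l" using F that c by auto
      then show ?thesis using x L that by (simp add: L_def)
    qed
    have "(\<Sum>l<p. H j l * F $$ (l, c)) = (\<Sum>l<p. 1 * (row L l \<bullet> x) * (row L l \<bullet> (P *\<^sub>v row L j)))"
      by (intro sum.cong) (auto simp: H_def entry mult_ac)
    also have "\<dots> = x \<bullet> row L j" by (rule dual) (use x rowc in auto)
    also have "\<dots> = F $$ (j, c)"
      using entry[OF j] comm_scalar_prod[OF x(1) rowc] by simp
    finally show "F $$ (j, c) = (\<Sum>l<p. H j l * F $$ (l, c))" by simp
  next
    fix j assume "j < p"
    show "(\<Sum>l<p. (H j l)\<^sup>2) = H j j"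
      using energy_P[OF rowc, of j] by (simp add: energy_def H_def)
  next
    show "(\<Sum>j<p. H j j) = real ?r" using trace by (simp add: H_def)
  qed
qed

section \<open>Contraction of the relative entropy\<close>

text \<open>Apply ln x \<le> x - 1 at \<open>u / c\<close> and \<open>v / c\<close> for the weighted
  mean \<open>c\<close>; the right-hand sides cancel.\<close>

lemma weighted_am_gm:
  fixes u v b :: real
  assumes u: "0 < u" and v: "0 < v" and b: "0 \<le> b" "b \<le> 1"
  shows "u powr b * v powr (1 - b) \<le> b * u + (1 - b) * v"
proof -
  define c where "c = b * u + (1 - b) * v"
  have c: "0 < c"
  proof (cases "b = 0")
    case False
    then have "0 < b * u" using u b by simp
    moreover have "0 \<le> (1 - b) * v" using v b by simp
    ultimately show ?thesis by (simp add: c_def)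
  qed (use v in \<open>simp add: c_def\<close>)
  have "b * ln (u / c) + (1 - b) * ln (v / c) \<le> b * (u / c - 1) + (1 - b) * (v / c - 1)"
    using u v b c by (intro add_mono mult_left_mono ln_le_minus_one) auto
  also have "\<dots> = (b * u + (1 - b) * v) / c - 1" using c by (simp add: field_simps)
  also have "\<dots> = 0" using c by (simp add: c_def)
  finally have "b * ln u + (1 - b) * ln v \<le> ln c"
    using u v c by (simp add: ln_div algebra_simps)
  then have "ln (u powr b * v powr (1 - b)) \<le> ln c"
    using u v by (simp add: ln_mult ln_powr)
  then show ?thesis using u v c unfolding c_def[symmetric] by simp
qed

text \<open>At the best t = a/c the assumption reads a^2/c \<le> s, and ln x \<le> x - 1 at x = c/a
  does the rest. If c were not positive, the left side of \<open>q\<close> would be unbounded in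
  t.\<close>

lemma ln_ge_of_quadratic_bound:
  fixes s a c :: real
  assumes a: "0 < a" and q: "\<And>t. 2 * t * a - t\<^sup>2 * c \<le> s"
  shows "1 - c / a \<le> ln (s / a)"
proof -
  have c: "0 < c"
  proof (rule ccontr)
    assume "\<not> 0 < c"
    then have "((\<bar>s\<bar> + 1) / a)\<^sup>2 * c \<le> 0" by (simp add: mult_nonneg_nonpos)
    then show False using q[of "(\<bar>s\<bar> + 1) / a"] a by simp
  qed
  have "a\<^sup>2 / c \<le> s" using q[of "a / c"] c by (simp add: power2_eq_square field_simps)
  then have le: "a / c \<le> s / a" using a c by (simp add: field_simps power2_eq_square)
  have "1 - c / a \<le> - ln (c / a)" using ln_le_minus_one[of "c / a"] a c by simp
  also have "\<dots> = ln (a / c)" using a c by (simp add: ln_div)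
  also have "\<dots> \<le> ln (s / a)" using le a c by (intro ln_mono) auto
  finally show ?thesis .
qed

text \<open>
  \<open>P w\<close> stands for the inverse of \<open>A\<^sup>T W\<^sup>b A\<close> with \<open>b = 1 - 2/p\<close>; then \<open>score w i\<close> is the trace of
  \<open>A\<^bsub>[i]\<^esub> P(w) A\<^bsub>[i]\<^esub>\<^sup>T\<close>, the scaled block leverage score is \<open>w\<^sub>i\<^sup>b score w i\<close>, and the Lewis weights
  \<open>v\<close> satisfy \<open>v\<^sub>i\<^bsup>1-b\<^esup> = score v i\<close>.
\<close>

locale lewis_iteration =
  fixes a :: "nat \<Rightarrow> real vec" and m n k :: nat and blk :: "nat \<Rightarrow> nat" and b :: real
    and P :: "(nat \<Rightarrow> real) \<Rightarrow> real mat" and v :: "nat \<Rightarrow> real"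
  assumes blk: "l < m \<Longrightarrow> blk l < k"
    and b: "0 < b" "b < 1"
    and gram: "(\<And>i. i < k \<Longrightarrow> 0 < w i) \<Longrightarrow> gram_dual a (\<lambda>l. w (blk l) powr b) m n (P w)"
    and v_pos: "i < k \<Longrightarrow> 0 < v i"
    and v_fixed: "i < k \<Longrightarrow>
      v i powr (1 - b) = (\<Sum>j | j < m \<and> blk j = i. a j \<bullet> (P v *\<^sub>v a j))"
begin

abbreviation pos :: "(nat \<Rightarrow> real) \<Rightarrow> bool" where
  "pos w \<equiv> \<forall>i<k. 0 < w i"

definition score :: "(nat \<Rightarrow> real) \<Rightarrow> nat \<Rightarrow> real" where
  "score w i = (\<Sum>j | j < m \<and> blk j = i. a j \<bullet> (P w *\<^sub>v a j))"

definition iterate :: "(nat \<Rightarrow> real) \<Rightarrow> nat \<Rightarrow> real" where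
  "iterate w i = w i powr b * score w i"

definition kl :: "(nat \<Rightarrow> real) \<Rightarrow> real" where
  "kl w = (\<Sum>i<k. v i * ln (v i / w i))"

text \<open>The quadratic form x^T M(w) x.\<close>

abbreviation en :: "(nat \<Rightarrow> real) \<Rightarrow> real vec \<Rightarrow> real" where
  "en w \<equiv> gram_dual.energy a (\<lambda>l. w (blk l) powr b) m"

lemma gd: "pos w \<Longrightarrow> gram_dual a (\<lambda>l. w (blk l) powr b) m n (P w)"
  using gram by blast

lemma pos_v: "pos v" using v_pos by blast

lemma score_v: "i < k \<Longrightarrow> score v i = v i powr (1 - b)"
  using v_fixed by (simp add: score_def)

lemma score_v_pos: "i < k \<Longrightarrow> 0 < score v i"
  using score_v v_pos by (metis powr_gt_zero less_irrefl)

lemma sum_blocks: "(\<Sum>i<k. \<Sum>j | j < m \<and> blk j = i. f j) = (\<Sum>j<m. f j)" for f :: "nat \<Rightarrow> real"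
proof -
  have "(\<Sum>i<k. \<Sum>j | j \<in> {..<m} \<and> blk j = i. f j) = (\<Sum>j<m. f j)"
    using blk by (intro sum.group) auto
  then show ?thesis by simp
qed

lemma sum_blocks_weighted:
  "(\<Sum>i<k. c i * (\<Sum>j | j < m \<and> blk j = i. f j)) = (\<Sum>j<m. c (blk j) * f j)"
  for c f :: "nat \<Rightarrow> real"
  unfolding sum_blocks[symmetric] sum_distrib_left by (intro sum.cong) auto

lemma rows: "l < m \<Longrightarrow> a l \<in> carrier_vec n"
  using gram_dual.rows[OF gd[OF pos_v]] .

lemma energy_blocks:
  assumes "pos w"
  shows "en w x = (\<Sum>i<k. w i powr b * (\<Sum>j | j < m \<and> blk j = i. (a j \<bullet> x)\<^sup>2))"
  unfolding gram_dual.energy_def[OF gd[OF assms]] sum_blocks_weighted ..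

lemma sum_iterate: "pos w \<Longrightarrow> (\<Sum>i<k. iterate w i) = real n"
  using gram_dual.trace[OF gd] by (simp add: iterate_def score_def sum_blocks_weighted)

lemma v_eq_iterate: "i < k \<Longrightarrow> v i = iterate v i"
  using v_pos[of i] by (simp add: iterate_def score_v powr_add[symmetric])

lemma sum_v: "(\<Sum>i<k. v i) = real n"
proof -
  have "(\<Sum>i<k. v i) = (\<Sum>i<k. iterate v i)" using v_eq_iterate by (intro sum.cong) auto
  then show ?thesis using sum_iterate[OF pos_v] by simp
qed

text \<open>Sum \<open>variational\<close> for P(w) over the test vectors P(v) a_j, with one common
  t so that it can be optimised per block.\<close>

lemma score_variational:
  assumes w: "pos w" and i: "i < k"
  shows "2 * t * score v i - t\<^sup>2 * (\<Sum>j | j < m \<and> blk j = i. en w (P v *\<^sub>v a j)) \<le> score w i"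
proof -
  interpret V: gram_dual a "\<lambda>l. v (blk l) powr b" m n "P v" by (rule gd[OF pos_v])
  interpret W: gram_dual a "\<lambda>l. w (blk l) powr b" m n "P w" by (rule gd[OF w])
  have "2 * t * score v i - t\<^sup>2 * (\<Sum>j | j < m \<and> blk j = i. en w (P v *\<^sub>v a j))
      = (\<Sum>j | j < m \<and> blk j = i. 2 * t * ((P v *\<^sub>v a j) \<bullet> a j) - t\<^sup>2 * en w (P v *\<^sub>v a j))"
    unfolding score_def sum_distrib_left sum_subtractf[symmetric]
    by (intro sum.cong) (auto simp: comm_scalar_prod[OF V.rows V.P_vec[OF V.rows]])
  also have "\<dots> \<le> score w i"
    unfolding score_def
    by (rule sum_mono, rule W.variational) (auto intro: V.P_vec V.rows)
  finally show ?thesis .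
qed

lemma score_pos:
  assumes w: "pos w" and i: "i < k"
  shows "0 < score w i"
proof -
  define c where "c = (\<Sum>j | j < m \<and> blk j = i. en w (P v *\<^sub>v a j))"
  have c: "0 \<le> c"
    unfolding c_def by (intro sum_nonneg) (rule gram_dual.energy_nonneg[OF gd[OF w]])
  have s: "0 < score v i" by (rule score_v_pos[OF i])
  \<comment> \<open>A t this small makes the bound of \<open>score_variational\<close> positive; the
    summand 1 covers c = 0.\<close>
  define t where "t = score v i / (c + 1)"
  have t: "0 < t" using s c by (simp add: t_def)
  have "t * c \<le> score v i" using s c by (simp add: t_def field_simps)
  then have "t * (t * c) \<le> t * score v i" using t by (intro mult_left_mono) auto
  then have "0 < 2 * t * score v i - t\<^sup>2 * c" using mult_pos_pos[OF t s]
    by (simp add: power2_eq_square mult_ac)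
  also have "\<dots> \<le> score w i"
    using score_variational[OF w i, of t] by (simp add: c_def)
  finally show ?thesis .
qed

lemma iterate_pos: "pos w \<Longrightarrow> pos (iterate w)"
  using score_pos by (auto simp: iterate_def intro!: mult_pos_pos)

lemma score_log_gain:
  assumes w: "pos w" and sum: "(\<Sum>i<k. w i) = real n"
  shows "0 \<le> (\<Sum>i<k. v i * ln (score w i / score v i))"
proof -
  interpret V: gram_dual a "\<lambda>l. v (blk l) powr b" m n "P v" by (rule gd[OF pos_v])
  interpret W: gram_dual a "\<lambda>l. w (blk l) powr b" m n "P w" by (rule gd[OF w])
  define c where "c = (\<lambda>i. \<Sum>j | j < m \<and> blk j = i. en w (P v *\<^sub>v a j))"
  have "(\<Sum>i<k. v i * (c i / score v i)) = (\<Sum>i<k. v i powr b * c i)"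
  proof (rule sum.cong[OF refl])
    fix i assume "i \<in> {..<k}"
    then have i: "i < k" by simp
    have "v i = v i powr b * score v i" using v_eq_iterate[OF i] by (simp add: iterate_def)
    then show "v i * (c i / score v i) = v i powr b * c i"
      using score_v_pos[OF i] by (simp add: field_simps)
  qed
  also have "\<dots> = (\<Sum>j<m. v (blk j) powr b * en w (P v *\<^sub>v a j))"
    unfolding c_def by (rule sum_blocks_weighted)
  \<comment> \<open>Both sides are Tr(P(v) M(w)): summing over j first, symmetry of P(v) makes the
    coefficient of each \<open>w (blk l) powr b\<close> the v-energy of P(v) a_l.\<close>
  also have "\<dots> = (\<Sum>l<m. w (blk l) powr b * V.energy (P v *\<^sub>v a l))"
    unfolding W.energy_def V.energy_def sum_distrib_left
    by (subst sum.swap) (auto intro!: sum.cong simp: V.symmetric[OF V.rows V.rows] mult_ac)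
  also have "\<dots> = (\<Sum>i<k. w i powr b * score v i)"
    unfolding score_def sum_blocks_weighted by (intro sum.cong) (auto simp: V.energy_P V.rows)
  \<comment> \<open>\<open>score v i\<close> is \<open>v i powr (1 - b)\<close>, so AM-GM applies
    termwise, and both weight vectors have total n.\<close>
  also have "\<dots> \<le> (\<Sum>i<k. b * w i + (1 - b) * v i)"
    using w v_pos b by (intro sum_mono) (auto simp: score_v intro!: weighted_am_gm)
  also have "\<dots> = b * (\<Sum>i<k. w i) + (1 - b) * (\<Sum>i<k. v i)"
    by (simp add: sum.distrib sum_distrib_left)
  also have "\<dots> = real n" by (simp add: sum sum_v algebra_simps)
  finally have le: "(\<Sum>i<k. v i * (c i / score v i)) \<le> real n" .
  have "(\<Sum>i<k. v i * (1 - c i / score v i)) \<le> (\<Sum>i<k. v i * ln (score w i / score v i))"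
  proof (intro sum_mono mult_left_mono)
    fix i assume "i \<in> {..<k}"
    then have i: "i < k" by simp
    show "1 - c i / score v i \<le> ln (score w i / score v i)"
      unfolding c_def by (rule ln_ge_of_quadratic_bound[OF score_v_pos[OF i] score_variational[OF w i]])
    show "0 \<le> v i" using v_pos[OF i] by simp
  qed
  moreover have "(\<Sum>i<k. v i * (1 - c i / score v i)) = real n - (\<Sum>i<k. v i * (c i / score v i))"
    by (simp add: right_diff_distrib sum_subtractf sum_v)
  ultimately show ?thesis using le by linarith
qed

lemma kl_iterate:
  assumes w: "pos w" and sum: "(\<Sum>i<k. w i) = real n"
  shows "kl (iterate w) \<le> b * kl w"
proof -
  \<comment> \<open>The part (1 - b) ln v_i of ln v_i that \<open>b * kl w\<close> leaves over is ln
    of \<open>score v i\<close>, by the fixed-point equation.\<close>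
  have "kl (iterate w) = b * kl w - (\<Sum>i<k. v i * ln (score w i / score v i))"
    unfolding kl_def sum_distrib_left sum_subtractf[symmetric]
  proof (rule sum.cong[OF refl])
    fix i assume "i \<in> {..<k}"
    then have i: "i < k" by simp
    have wi: "0 < w i" using w i by simp
    note p = v_pos[OF i] score_pos[OF w i]
    have 1: "ln (v i / iterate w i) = ln (v i) - b * ln (w i) - ln (score w i)"
      using p wi by (simp add: iterate_def ln_div ln_mult ln_powr)
    have 2: "ln (score w i / score v i) = ln (score w i) - (1 - b) * ln (v i)"
      using p by (simp add: score_v[OF i] ln_div ln_powr)
    have 3: "ln (v i / w i) = ln (v i) - ln (w i)" using p wi by (simp add: ln_div)
    show "v i * ln (v i / iterate w i)
        = b * (v i * ln (v i / w i)) - v i * ln (score w i / score v i)"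
      unfolding 1 2 3 by (simp add: algebra_simps)
  qed
  then show ?thesis using score_log_gain[OF w sum] by simp
qed

lemma funpow_iterate:
  assumes "pos w" and "(\<Sum>i<k. w i) = real n"
  shows "pos ((iterate ^^ t) w) \<and> (\<Sum>i<k. (iterate ^^ t) w i) = real n
    \<and> kl ((iterate ^^ t) w) \<le> b ^ t * kl w"
proof (induction t)
  case (Suc t)
  let ?u = "(iterate ^^ t) w"
  have "kl (iterate ?u) \<le> b * kl ?u" using Suc by (intro kl_iterate) auto
  also have "\<dots> \<le> b * (b ^ t * kl w)" using Suc b by (intro mult_left_mono) auto
  finally show ?case using Suc iterate_pos[of ?u] sum_iterate[of ?u] by (simp add: mult_ac)
qed (use assms in auto)

section \<open>From small entropy to a spectral approximation\<close>

text \<open>Use ln(sqrt r) \<le> sqrt r - 1 termwise with r = w_i/v_i; the added differences w_i -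
  v_i sum to zero because both totals are n.\<close>

lemma hellinger_le_kl:
  assumes w: "pos w" and sum: "(\<Sum>i<k. w i) = real n"
  shows "(\<Sum>i<k. v i * (sqrt (w i / v i) - 1)\<^sup>2) \<le> kl w"
proof -
  have "(\<Sum>i<k. v i * (sqrt (w i / v i) - 1)\<^sup>2) \<le> (\<Sum>i<k. (w i - v i) + v i * ln (v i / w i))"
  proof (rule sum_mono)
    fix i assume "i \<in> {..<k}"
    then have i: "0 < v i" "0 < w i" using w v_pos by auto
    define r where "r = w i / v i"
    have r: "0 < r" "w i = r * v i" using i by (auto simp: r_def)
    have "ln (sqrt r) \<le> sqrt r - 1" using r by (intro ln_le_minus_one) simp
    then have "2 - 2 * sqrt r \<le> - ln r" using r by (simp add: ln_sqrt)
    then have "v i * (2 - 2 * sqrt r) \<le> v i * (- ln r)" using i by (intro mult_left_mono) auto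
    moreover have "v i * (sqrt r - 1)\<^sup>2 = r * v i - v i + v i * (2 - 2 * sqrt r)"
      using r by (simp add: power2_diff algebra_simps)
    moreover have "v i * (- ln r) = v i * ln (v i / w i)" using i by (simp add: r_def ln_div)
    ultimately show "v i * (sqrt (w i / v i) - 1)\<^sup>2 \<le> (w i - v i) + v i * ln (v i / w i)"
      unfolding r_def[symmetric] using r(2) by linarith
  qed
  also have "\<dots> = kl w" by (simp add: sum.distrib sum_subtractf sum sum_v kl_def)
  finally show ?thesis .
qed

text \<open>As 0 < b < 1, r^b lies between 1 and r; then r - 1 is expressed through sqrt r - 1,
  which the Hellinger bound controls.\<close>

lemma powr_diff_one_le:
  fixes r :: real
  assumes "0 < r"
  shows "\<bar>r powr b - 1\<bar> \<le> 2 * \<bar>sqrt r - 1\<bar> + (sqrt r - 1)\<^sup>2"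
proof -
  have quad: "\<bar>2 * y + y\<^sup>2\<bar> \<le> 2 * \<bar>y\<bar> + y\<^sup>2" for y :: real
    using abs_triangle_ineq[of "2 * y" "y\<^sup>2"] by (simp add: abs_mult)
  have "\<bar>r powr b - 1\<bar> \<le> \<bar>r - 1\<bar>"
  proof (cases "r \<ge> 1")
    case True
    then have "r powr b \<le> r" using powr_mono[of b 1 r] b by simp
    moreover have "1 \<le> r powr b" using True b by (simp add: ge_one_powr_ge_zero)
    ultimately show ?thesis by simp
  next
    case False
    then have "r \<le> r powr b" using powr_mono'[of b 1 r] b assms by simp
    moreover have "r powr b \<le> 1" using False b assms by (simp add: powr_le1)
    ultimately show ?thesis by simp
  qed
  also have "r - 1 = 2 * (sqrt r - 1) + (sqrt r - 1)\<^sup>2"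
    using assms by (simp add: power2_diff)
  also have "\<bar>\<dots>\<bar> \<le> 2 * \<bar>sqrt r - 1\<bar> + (sqrt r - 1)\<^sup>2"
    by (rule quad)
  finally show ?thesis .
qed

text \<open>The energies differ by the sum of q_i (r_i^b - 1), where r_i = w_i/v_i and q_i is the
  part of the v-energy in block i. Since q_i is at most v_i times the whole, the Hellinger bound
  controls the sum of \<open>q i * (h i)\<^sup>2\<close>, and through it the sum of
  \<open>q i * \<bar>h i\<bar>\<close>.\<close>

lemma energy_approx:
  assumes w: "pos w" and sum: "(\<Sum>i<k. w i) = real n"
    and d: "0 \<le> d" "kl w \<le> d\<^sup>2" and x: "x \<in> carrier_vec n"
  shows "\<bar>en w x - en v x\<bar> \<le> (2 * d + d\<^sup>2) * en v x"
proof -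
  interpret V: gram_dual a "\<lambda>l. v (blk l) powr b" m n "P v" by (rule gd[OF pos_v])
  define e where "e = (\<lambda>i. \<Sum>j | j < m \<and> blk j = i. (a j \<bullet> x)\<^sup>2)"
  define q where "q = (\<lambda>i. v i powr b * e i)"
  define h where "h = (\<lambda>i. sqrt (w i / v i) - 1)"
  have e0: "0 \<le> e i" for i unfolding e_def by (intro sum_nonneg) simp
  have q0: "0 \<le> q i" for i using e0 by (simp add: q_def)
  have E0: "0 \<le> en v x" by (rule V.energy_nonneg)
  have sumq: "(\<Sum>i<k. q i) = en v x" using energy_blocks[OF pos_v] by (simp add: q_def e_def)
  have qle: "q i \<le> v i * en v x" if i: "i < k" for i
  proof -
    have "e i \<le> (\<Sum>j | j < m \<and> blk j = i. en v x * (a j \<bullet> (P v *\<^sub>v a j)))"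
      unfolding e_def
    proof (rule sum_mono)
      fix j assume j: "j \<in> {j. j < m \<and> blk j = i}"
      then show "(a j \<bullet> x)\<^sup>2 \<le> en v x * (a j \<bullet> (P v *\<^sub>v a j))"
        using V.cauchy_schwarz[OF x V.rows, of j] comm_scalar_prod[OF x V.rows, of j] by simp
    qed
    also have "\<dots> = en v x * score v i" by (simp add: score_def sum_distrib_left)
    finally have "q i \<le> v i powr b * (en v x * score v i)"
      unfolding q_def by (intro mult_left_mono) auto
    also have "\<dots> = v i * en v x"
      using v_eq_iterate[OF i] unfolding iterate_def by (metis mult.assoc mult.commute)
    finally show ?thesis .
  qed
  have "(\<Sum>i<k. q i * (h i)\<^sup>2) \<le> (\<Sum>i<k. en v x * (v i * (h i)\<^sup>2))"
  proof (rule sum_mono)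
    fix i assume "i \<in> {..<k}"
    then have "q i * (h i)\<^sup>2 \<le> (v i * en v x) * (h i)\<^sup>2" using qle by (intro mult_right_mono) auto
    then show "q i * (h i)\<^sup>2 \<le> en v x * (v i * (h i)\<^sup>2)" by (simp add: mult_ac)
  qed
  also have "\<dots> = en v x * (\<Sum>i<k. v i * (h i)\<^sup>2)" by (simp add: sum_distrib_left)
  also have "\<dots> \<le> en v x * d\<^sup>2"
    using hellinger_le_kl[OF w sum] d E0 by (intro mult_left_mono) (auto simp: h_def)
  finally have h2: "(\<Sum>i<k. q i * (h i)\<^sup>2) \<le> en v x * d\<^sup>2" .
  have h1: "(\<Sum>i<k. q i * \<bar>h i\<bar>) \<le> en v x * d"
  \<comment> \<open>For d > 0, |h| \<le> d/2 + h^2/(2d) stands in for Cauchy-Schwarz with weights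
    q_i.\<close>
  proof (cases "d = 0")
    case True
    then have "(\<Sum>i<k. q i * (h i)\<^sup>2) = 0"
      using h2 q0 by (intro antisym sum_nonneg) auto
    then have "\<forall>i\<in>{..<k}. q i * (h i)\<^sup>2 = 0"
      using q0 by (subst (asm) sum_nonneg_eq_0_iff) auto
    then have "(\<Sum>i<k. q i * \<bar>h i\<bar>) = 0" by (auto intro!: sum.neutral)
    then show ?thesis using True by simp
  next
    case False
    then have d0: "0 < d" using d by simp
    have "(\<Sum>i<k. q i * \<bar>h i\<bar>) \<le> (\<Sum>i<k. q i * (d / 2 + (h i)\<^sup>2 / (2 * d)))"
    proof (intro sum_mono mult_left_mono q0)
      fix i
      have "0 \<le> (\<bar>h i\<bar> - d)\<^sup>2" by simp
      then have "2 * d * \<bar>h i\<bar> \<le> d\<^sup>2 + (h i)\<^sup>2" by (simp add: power2_diff mult_ac)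
      then show "\<bar>h i\<bar> \<le> d / 2 + (h i)\<^sup>2 / (2 * d)"
        using d0 by (simp add: field_simps power2_eq_square)
    qed
    also have "\<dots> = d / 2 * (\<Sum>i<k. q i) + (\<Sum>i<k. q i * (h i)\<^sup>2) / (2 * d)"
      unfolding sum_distrib_left sum_divide_distrib sum.distrib[symmetric]
      by (intro sum.cong) (auto simp: algebra_simps)
    also have "\<dots> \<le> d / 2 * en v x + en v x * d\<^sup>2 / (2 * d)"
      unfolding sumq using h2 d0 by (intro add_left_mono divide_right_mono) auto
    also have "\<dots> = en v x * d" using d0 by (simp add: field_simps power2_eq_square)
    finally show ?thesis .
  qed
  have "en w x - en v x = (\<Sum>i<k. q i * ((w i / v i) powr b - 1))"
    unfolding energy_blocks[OF w] energy_blocks[OF pos_v] sum_subtractf[symmetric] q_def e_def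
  proof (rule sum.cong[OF refl])
    fix i assume "i \<in> {..<k}"
    then have "0 < v i" "0 < w i" using w v_pos by auto
    then show "w i powr b * y - v i powr b * y = v i powr b * y * ((w i / v i) powr b - 1)" for y
      by (simp add: powr_divide algebra_simps)
  qed
  also have "\<bar>\<dots>\<bar> \<le> (\<Sum>i<k. \<bar>q i * ((w i / v i) powr b - 1)\<bar>)" by (rule sum_abs)
  also have "\<dots> \<le> (\<Sum>i<k. q i * (2 * \<bar>h i\<bar> + (h i)\<^sup>2))"
  proof (rule sum_mono)
    fix i assume "i \<in> {..<k}"
    then have "0 < w i / v i" using w v_pos by simp
    then show "\<bar>q i * ((w i / v i) powr b - 1)\<bar> \<le> q i * (2 * \<bar>h i\<bar> + (h i)\<^sup>2)"
      unfolding abs_mult h_def using q0[of i] powr_diff_one_le by (simp add: mult_left_mono)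
  qed
  also have "\<dots> = 2 * (\<Sum>i<k. q i * \<bar>h i\<bar>) + (\<Sum>i<k. q i * (h i)\<^sup>2)"
    unfolding sum_distrib_left sum.distrib[symmetric]
    by (intro sum.cong) (auto simp: algebra_simps)
  also have "\<dots> \<le> (2 * d + d\<^sup>2) * en v x" using h1 h2 by (simp add: algebra_simps)
  finally show ?thesis .
qed

text \<open>Inversion reverses the order of quadratic forms. In terms of \<open>variational\<close>,
  the lower bound comes from the test vector P(v) y with t = 1/(1 + e), the upper bound from P(w) y
  with t = 1 - e.\<close>

lemma score_approx:
  assumes w: "pos w" and e: "0 \<le> e" "e < 1" and i: "i < k"
    and approx: "\<And>x. x \<in> carrier_vec n \<Longrightarrow> \<bar>en w x - en v x\<bar> \<le> e * en v x"
  shows "score v i / (1 + e) \<le> score w i" "score w i \<le> score v i / (1 - e)"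
proof -
  interpret V: gram_dual a "\<lambda>l. v (blk l) powr b" m n "P v" by (rule gd[OF pos_v])
  interpret W: gram_dual a "\<lambda>l. w (blk l) powr b" m n "P w" by (rule gd[OF w])
  have lower: "(y \<bullet> (P v *\<^sub>v y)) / (1 + e) \<le> y \<bullet> (P w *\<^sub>v y)" if y: "y \<in> carrier_vec n" for y
  proof -
    define f t where "f = y \<bullet> (P v *\<^sub>v y)" and "t = 1 / (1 + e)"
    have "en w (P v *\<^sub>v y) \<le> (1 + e) * f"
      using approx[OF V.P_vec[OF y]] by (simp add: V.energy_P[OF y] f_def algebra_simps)
    then have "t\<^sup>2 * en w (P v *\<^sub>v y) \<le> t\<^sup>2 * ((1 + e) * f)" by (intro mult_left_mono) auto
    also have "\<dots> = t * f" using e by (simp add: t_def power2_eq_square)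
    finally have "t * f \<le> y \<bullet> (P w *\<^sub>v y)"
      using W.variational[OF V.P_vec[OF y] y, of t] comm_scalar_prod[OF V.P_vec[OF y] y]
      by (simp add: f_def)
    then show ?thesis by (simp add: f_def t_def)
  qed
  have upper: "(1 - e) * (y \<bullet> (P w *\<^sub>v y)) \<le> y \<bullet> (P v *\<^sub>v y)" if y: "y \<in> carrier_vec n" for y
  proof -
    define f t where "f = y \<bullet> (P w *\<^sub>v y)" and "t = 1 - e"
    have "t * en v (P w *\<^sub>v y) \<le> f"
      using approx[OF W.P_vec[OF y]] by (simp add: W.energy_P[OF y] f_def t_def algebra_simps)
    then have "t * (t * en v (P w *\<^sub>v y)) \<le> t * f" using e by (intro mult_left_mono) (auto simp: t_def)
    then have "t * f \<le> y \<bullet> (P v *\<^sub>v y)"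
      using V.variational[OF W.P_vec[OF y] y, of t] comm_scalar_prod[OF W.P_vec[OF y] y]
      by (simp add: f_def power2_eq_square)
    then show ?thesis by (simp add: f_def t_def)
  qed
  show "score v i / (1 + e) \<le> score w i"
    unfolding score_def sum_divide_distrib by (intro sum_mono lower) (auto intro: rows)
  have "(1 - e) * score w i \<le> score v i"
    unfolding score_def sum_distrib_left by (intro sum_mono upper) (auto intro: rows)
  then show "score w i \<le> score v i / (1 - e)" using e by (simp add: field_simps)
qed

end

section \<open>Scaled matrices and the algorithm\<close>

lemma block_scale_carrier:
  assumes "A \<in> carrier_mat m n"
  shows "block_scale blk d A \<in> carrier_mat m n"
proof -
  have "dim_row A = m" using assms by simp
  then show ?thesis
    unfolding block_scale_def using mult_carrier_mat[OF mat_diag_dim assms] by simp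
qed

lemma row_block_scale:
  assumes "A \<in> carrier_mat m n" "j < m"
  shows "row (block_scale blk d A) j = d (blk j) \<cdot>\<^sub>v row A j"
  using assms by (intro eq_vecI) (auto simp: block_scale_def mat_diag_mult_left)

text \<open>The Gram matrix of D A is that of the rows of A with weights d^2. As the scaling is
  positive, D A inherits the trivial kernel of A.\<close>

lemma gram_dual_block_scale:
  assumes A: "A \<in> carrier_mat m n" and rank: "mat_rank A = n"
    and blk: "\<And>j. j < m \<Longrightarrow> blk j < k" and d: "\<And>i. i < k \<Longrightarrow> 0 < d i"
  shows "gram_dual (row A) (\<lambda>l. (d (blk l))\<^sup>2) m n (gram_inverse (block_scale blk d A))"
proof -
  let ?B = "block_scale blk d A"
  have B: "?B \<in> carrier_mat m n" by (rule block_scale_carrier[OF A])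
  have dot: "row ?B l \<bullet> x = d (blk l) * (row A l \<bullet> x)" if "l < m" "x \<in> carrier_vec n" for l x
    using that A by (simp add: row_block_scale[OF A])
  have inj: "x = 0\<^sub>v n" if x: "x \<in> carrier_vec n" and Bx: "?B *\<^sub>v x = 0\<^sub>v m" for x
  proof (rule full_col_rank_inj[OF A rank x])
    show "A *\<^sub>v x = 0\<^sub>v m"
    proof (rule eq_vecI)
      fix l assume "l < dim_vec (0\<^sub>v m :: real vec)"
      then have l: "l < m" by simp
      have "row ?B l \<bullet> x = (?B *\<^sub>v x) $ l" using B l by simp
      then have "d (blk l) * (row A l \<bullet> x) = 0" using dot[OF l x] Bx l by simp
      then show "(A *\<^sub>v x) $ l = 0\<^sub>v m $ l" using d[OF blk[OF l]] A l by simp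
    qed (use A in simp)
  qed
  interpret gram_dual "row ?B" "\<lambda>_. 1" m n "gram_inverse ?B"
    by (rule gram_dual_gram_inverse[OF B inj])
  show ?thesis
  proof
    fix x y :: "real vec"
    assume x: "x \<in> carrier_vec n" and y: "y \<in> carrier_vec n"
    have "(\<Sum>l<m. (d (blk l))\<^sup>2 * (row A l \<bullet> x) * (row A l \<bullet> (gram_inverse ?B *\<^sub>v y)))
        = (\<Sum>l<m. 1 * (row ?B l \<bullet> x) * (row ?B l \<bullet> (gram_inverse ?B *\<^sub>v y)))"
      by (intro sum.cong) (auto simp: dot x P_vec[OF y] power2_eq_square)
    then show "(\<Sum>l<m. (d (blk l))\<^sup>2 * (row A l \<bullet> x) * (row A l \<bullet> (gram_inverse ?B *\<^sub>v y))) = x \<bullet> y"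
      by (simp add: dual[OF x y, simplified])
  qed (use A P in auto)
qed

lemma leverage_score_block_scale:
  assumes A: "A \<in> carrier_mat m n" and P: "gram_inverse (block_scale blk d A) \<in> carrier_mat n n"
    and j: "j < m"
  shows "leverage_score (block_scale blk d A) j
    = (d (blk j))\<^sup>2 * (row A j \<bullet> (gram_inverse (block_scale blk d A) *\<^sub>v row A j))"
proof -
  have r: "row A j \<in> carrier_vec n" using A j by auto
  have "gram_inverse (block_scale blk d A) *\<^sub>v row A j \<in> carrier_vec n" using P r by simp
  then show ?thesis
    using r by (simp add: leverage_score_def row_block_scale[OF A j] mult_mat_vec[OF P r]
        power2_eq_square)
qed

lemma bij_betw_pick:
  assumes "finite J"
  shows "bij_betw (pick J) {..<card J} J"
proof -
  have "inj_on (pick J) {..<card J}"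
    by (rule inj_onI) (metis lessThan_iff nat_neq_iff pick_mono_le)
  then show ?thesis
    unfolding bij_betw_def using pick_in_set_le assms
    by (metis card_image card_lessThan card_subset_eq image_subsetI lessThan_iff)
qed

text \<open>Each row of the block is a combination of the block's rows with a row of the projection
  H as coefficients, so its weighted leverage score is at most the diagonal entry of H; the trace of
  H is the rank.\<close>

lemma block_leverage_le_rank:
  assumes A: "A \<in> carrier_mat m n"
    and G: "gram_dual (row A) g m n P"
    and g: "\<And>j. j < m \<Longrightarrow> blk j = i \<Longrightarrow> g j = c" and c: "0 \<le> c"
  shows "c * (\<Sum>j | j < m \<and> blk j = i. row A j \<bullet> (P *\<^sub>v row A j))
    \<le> real (mat_rank (row_block A blk i))"
proof -
  interpret gram_dual "row A" g m n P by (rule G)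
  define J where "J = {j. j < m \<and> blk j = i}"
  define F where "F = row_block A blk i"
  let ?r = "card J"
  have Jm: "J \<subseteq> {..<m}" and finJ: "finite J" by (auto simp: J_def)
  have Fdef: "F = submatrix A J UNIV" unfolding F_def row_block_def J_def using A by simp
  have "{a. a < m \<and> a \<in> J} = J" by (auto simp: J_def)
  then have card_eq: "card {a. a < m \<and> a \<in> J} = ?r" by simp
  have F: "F \<in> carrier_mat ?r n"
    unfolding Fdef by (rule carrier_matI) (use A in \<open>simp_all add: dim_submatrix card_eq\<close>)
  have entry: "F $$ (t, s) = A $$ (pick J t, s)" if "t < ?r" "s < n" for t s
    unfolding Fdef using that A by (subst submatrix_index) (simp_all add: card_eq pick_UNIV)
  have bij: "bij_betw (pick J) {..<?r} J" by (rule bij_betw_pick[OF finJ])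
  have pickJ: "pick J t \<in> J" if "t < ?r" for t using that by (rule pick_in_set_le)
  obtain H :: "nat \<Rightarrow> nat \<Rightarrow> real" where
    H1: "\<And>t s. t < ?r \<Longrightarrow> s < n \<Longrightarrow> F $$ (t, s) = (\<Sum>l<?r. H t l * F $$ (l, s))" and
    H2: "\<And>t. t < ?r \<Longrightarrow> (\<Sum>l<?r. (H t l)\<^sup>2) = H t t" and
    H3: "(\<Sum>t<?r. H t t) = real (mat_rank F)"
    by (rule col_space_projection[OF F]) blast
  \<comment> \<open>Rows of the block are numbered below \<open>?r\<close> in \<open>F\<close> but
    keep their original index in \<open>A\<close>; \<open>h\<close> leads from the latter to the
    former.\<close>
  define h where "h = the_inv_into {..<?r} (pick J)"
  have h: "h (pick J t) = t" if "t < ?r" for t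
    unfolding h_def using bij that by (intro the_inv_into_f_f) (auto simp: bij_betw_def)
  have reindex: "(\<Sum>l\<in>J. f (h l) l) = (\<Sum>s<?r. f s (pick J s))" for f :: "nat \<Rightarrow> nat \<Rightarrow> real"
    by (subst sum.reindex_bij_betw[OF bij, symmetric]) (simp add: h)
  have dotF: "row A (pick J t) \<bullet> x = (\<Sum>s<n. F $$ (t, s) * x $ s)"
    if "t < ?r" "x \<in> carrier_vec n" for t x
    using that A pickJ[OF that(1)] by (auto simp: scalar_prod_def entry lessThan_atLeast0 J_def)
  have bound: "c * (row A (pick J t) \<bullet> (P *\<^sub>v row A (pick J t))) \<le> H t t" if t: "t < ?r" for t
  proof -
    have "c * (row A (pick J t) \<bullet> (P *\<^sub>v row A (pick J t))) \<le> (\<Sum>l\<in>J. (H t (h l))\<^sup>2)"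
    proof (rule leverage_le_norm_coeffs[OF Jm _ c])
      show "row A (pick J t) \<in> carrier_vec n" using pickJ[OF t] by (intro rows) (auto simp: J_def)
      fix x :: "real vec" assume x: "x \<in> carrier_vec n"
      have "row A (pick J t) \<bullet> x = (\<Sum>s<n. \<Sum>l<?r. H t l * F $$ (l, s) * x $ s)"
        unfolding dotF[OF t x] using H1[OF t] by (simp add: sum_distrib_right)
      also have "\<dots> = (\<Sum>l<?r. H t l * (row A (pick J l) \<bullet> x))"
        by (subst sum.swap) (simp add: dotF x sum_distrib_left mult.assoc)
      also have "\<dots> = (\<Sum>l\<in>J. H t (h l) * (row A l \<bullet> x))"
        using reindex[of "\<lambda>s l. H t s * (row A l \<bullet> x)"] by simp
      finally show "row A (pick J t) \<bullet> x = (\<Sum>l\<in>J. H t (h l) * (row A l \<bullet> x))" .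
    qed (use g in \<open>auto simp: J_def\<close>)
    also have "\<dots> = H t t" using reindex[of "\<lambda>s l. (H t s)\<^sup>2"] H2[OF t] by simp
    finally show ?thesis .
  qed
  have "c * (\<Sum>j\<in>J. row A j \<bullet> (P *\<^sub>v row A j))
      = (\<Sum>t<?r. c * (row A (pick J t) \<bullet> (P *\<^sub>v row A (pick J t))))"
    by (subst sum.reindex_bij_betw[OF bij, symmetric]) (simp add: sum_distrib_left)
  also have "\<dots> \<le> (\<Sum>t<?r. H t t)" using bound by (intro sum_mono) auto
  finally show ?thesis using H3 unfolding J_def F_def by simp
qed

section \<open>Numerical estimates\<close>

text \<open>The factors 1 + e and 1/(1 - e) are at most exp e and exp(2e), and the power p/2 only
  multiplies these exponents, to at most \<epsilon>/4 and \<epsilon>/2.\<close>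

lemma powr_approx:
  fixes p \<epsilon> e s t :: real
  assumes p: "2 < p" and eps: "0 < \<epsilon>" "\<epsilon> < 1" and e: "0 \<le> e" "e \<le> \<epsilon> / (2 * p)"
    and t: "0 < t" and le: "t / (1 + e) \<le> s" "s \<le> t / (1 - e)"
  shows "(1 - \<epsilon>) * t powr (p / 2) \<le> s powr (p / 2)" "s powr (p / 2) \<le> (1 + \<epsilon>) * t powr (p / 2)"
proof -
  have "\<epsilon> / (2 * p) \<le> 1 / 4" using p eps by (simp add: field_simps)
  then have e4: "e \<le> 1 / 4" using e by linarith
  have "0 < t / (1 + e)" using t e by simp
  then have s: "0 < s" using le(1) by linarith
  have pe: "p * e \<le> \<epsilon> / 2" using e(2) p by (simp add: field_simps)
  have t0: "0 < t powr (p / 2)" using t by simp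
  have exp_powr: "(exp c * z) powr (p / 2) = exp (p * c / 2) * z powr (p / 2)" if "0 < z" for c z :: real
  proof -
    have "(exp c) powr (p / 2) = exp (p * c / 2)" by (simp add: powr_def)
    then show ?thesis using that by (simp add: powr_mult)
  qed
  have "t \<le> (1 + e) * s" using le(1) e by (simp add: field_simps)
  also have "\<dots> \<le> exp e * s" using s exp_ge_add_one_self[of e] by (intro mult_right_mono) auto
  finally have "t powr (p / 2) \<le> (exp e * s) powr (p / 2)" using t p by (intro powr_mono2) auto
  also have "\<dots> = exp (p * e / 2) * s powr (p / 2)"
    using exp_powr[of s e] s by simp
  also have "\<dots> \<le> exp \<epsilon> * s powr (p / 2)"
    using pe eps by (intro mult_right_mono) auto
  finally have "exp (- \<epsilon>) * t powr (p / 2) \<le> s powr (p / 2)"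
    by (simp add: exp_minus field_simps)
  moreover have "(1 - \<epsilon>) * t powr (p / 2) \<le> exp (- \<epsilon>) * t powr (p / 2)"
    using exp_ge_add_one_self[of "- \<epsilon>"] t0 by (intro mult_right_mono) auto
  ultimately show "(1 - \<epsilon>) * t powr (p / 2) \<le> s powr (p / 2)" by linarith
  have "1 / (1 - e) \<le> 1 + 2 * e"
  proof -
    have "0 \<le> e * (1 - 2 * e)" using e e4 by simp
    then have "1 \<le> (1 + 2 * e) * (1 - e)" by (simp add: algebra_simps)
    then show ?thesis using e4 by (simp add: field_simps)
  qed
  also have "\<dots> \<le> exp (2 * e)" by (rule exp_ge_add_one_self)
  finally have "1 / (1 - e) * t \<le> exp (2 * e) * t" using t by (intro mult_right_mono) auto
  then have "s \<le> exp (2 * e) * t" using le(2) by simp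
  then have "s powr (p / 2) \<le> (exp (2 * e) * t) powr (p / 2)" using s p by (intro powr_mono2) auto
  also have "\<dots> = exp (p * e) * t powr (p / 2)"
    using exp_powr[of t "2 * e"] t by simp
  also have "\<dots> \<le> (1 + \<epsilon>) * t powr (p / 2)"
  proof (rule mult_right_mono)
    have "exp (p * e) \<le> exp (\<epsilon> / 2)" using pe by simp
    also have "\<dots> \<le> 1 + \<epsilon> / 2 + (\<epsilon> / 2)\<^sup>2" using eps by (intro exp_bound) auto
    also have "\<dots> \<le> 1 + \<epsilon>"
    proof -
      have "\<epsilon> * \<epsilon> \<le> \<epsilon> * 1" using eps by (intro mult_left_mono) auto
      moreover have "(\<epsilon> / 2)\<^sup>2 = \<epsilon> * \<epsilon> / 4" by (simp add: power2_eq_square)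
      ultimately show ?thesis using eps by linarith
    qed
    finally show "exp (p * e) \<le> 1 + \<epsilon>" .
  qed simp
  finally show "s powr (p / 2) \<le> (1 + \<epsilon>) * t powr (p / 2)" .
qed

text \<open>The output depends on the score at the weights before the last update, which have gone
  through N - 1 contractions. The missing one costs a factor of at most exp(2/p) \<le> exp
  1.\<close>

lemma contraction_after_iterations:
  fixes p \<epsilon> :: real
  assumes p: "2 < p" and eps: "0 < \<epsilon>" "\<epsilon> < 1" and R: "1 \<le> R"
    and N: "Suc t = lewis_num_iterations p \<epsilon> R"
  shows "(1 - 2 / p) ^ t * real R \<le> (11 / 50 * \<epsilon> / p)\<^sup>2"
proof -
  define X where "X = 8 * p * sqrt (real R) / \<epsilon>"
  have sR: "1 \<le> sqrt (real R)" using R by simp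
  have X: "0 < X" using p eps sR by (simp add: X_def)
  have "p * ln X \<le> real (nat \<lceil>p * ln X\<rceil>)" by linarith
  then have "p * ln X \<le> real t + 1"
    using N unfolding lewis_num_iterations_def X_def[symmetric] by (metis of_nat_Suc add.commute)
  then have "2 * ln X \<le> 2 / p * real t + 2 / p" using p by (simp add: field_simps)
  moreover have "2 / p \<le> 1" using p by simp
  ultimately have tl: "2 * ln X - 1 \<le> 2 / p * real t" by linarith
  have "(1 - 2 / p) ^ t \<le> exp (- 2 / p) ^ t"
    using p exp_ge_add_one_self[of "- 2 / p"] by (intro power_mono) auto
  also have "\<dots> = exp (- (2 / p * real t))" by (simp add: exp_of_nat_mult[symmetric] mult_ac)
  also have "\<dots> \<le> exp (1 - 2 * ln X)" using tl by simp
  also have "\<dots> = exp 1 / X\<^sup>2"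
    using X by (simp add: exp_diff exp_of_nat_mult[of 2 "ln X", simplified])
  also have "\<dots> \<le> 3 / X\<^sup>2" using exp_le by (intro divide_right_mono) auto
  finally have "(1 - 2 / p) ^ t * real R \<le> 3 / X\<^sup>2 * real R" by (rule mult_right_mono) simp
  also have "\<dots> = 3 / 64 * (\<epsilon> / p)\<^sup>2"
    using p eps R by (simp add: X_def power_divide power_mult_distrib)
  \<comment> \<open>11/50 is just above the square root of 3/64, and small enough that d = 11/50 *
    \<epsilon>/p gives 2d + d^2 \<le> \<epsilon>/(2p).\<close>
  also have "\<dots> \<le> (11 / 50)\<^sup>2 * (\<epsilon> / p)\<^sup>2" by (intro mult_right_mono) (auto simp: power2_eq_square)
  finally show ?thesis by (simp add: power_divide power_mult_distrib)
qed

text \<open>The argument Y of the logarithm in the bound is at least 2, so ln 8 \<le> 3 ln Y, and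
  the 1 lost by rounding up is at most p ln Y. Hence the constant 3 + 1 + 1.\<close>

lemma lewis_num_iterations_bounds:
  fixes p \<epsilon> :: real
  assumes p: "2 < p" and eps: "0 < \<epsilon>" "\<epsilon> < 1" and R: "1 \<le> R"
  shows "0 < lewis_num_iterations p \<epsilon> R"
    "real (lewis_num_iterations p \<epsilon> R) \<le> 5 * p * ln (p * sqrt (real R) / \<epsilon>)"
proof -
  define Y where "Y = p * sqrt (real R) / \<epsilon>"
  have sR: "1 \<le> sqrt (real R)" using R by simp
  have "2 * 1 \<le> p * sqrt (real R)" using p sR by (intro mult_mono) auto
  moreover have "p * sqrt (real R) * \<epsilon> \<le> p * sqrt (real R) * 1"
    using p eps by (intro mult_left_mono) auto
  ultimately have Y: "2 \<le> Y" unfolding Y_def using eps by (simp add: le_divide_eq)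
  have ln2: "1 / 2 \<le> ln (2 :: real)" using ln_le_minus_one[of "1 / 2 :: real"] by (simp add: ln_div)
  have lnY: "ln 2 \<le> ln Y" using Y by simp
  have "ln (8 * Y) = 3 * ln 2 + ln Y"
    using Y ln_realpow[of 2 3] by (simp add: ln_mult)
  then have u: "ln (8 * Y) \<le> 4 * ln Y" and l: "0 < ln (8 * Y)" using lnY ln2 by linarith+
  have N: "lewis_num_iterations p \<epsilon> R = nat \<lceil>p * ln (8 * Y)\<rceil>"
    by (simp add: lewis_num_iterations_def Y_def mult.assoc)
  have pos: "0 < p * ln (8 * Y)" using l p by simp
  then show "0 < lewis_num_iterations p \<epsilon> R" unfolding N by simp
  have "real (lewis_num_iterations p \<epsilon> R) \<le> p * ln (8 * Y) + 1" unfolding N using pos by linarith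
  also have "p * ln (8 * Y) \<le> p * (4 * ln Y)" using u p by (intro mult_left_mono) auto
  also have "1 \<le> p * ln Y"
  proof -
    have "2 * (1 / 2) \<le> p * ln Y" using p lnY ln2 by (intro mult_mono) auto
    then show ?thesis by simp
  qed
  finally show "real (lewis_num_iterations p \<epsilon> R) \<le> 5 * p * ln (p * sqrt (real R) / \<epsilon>)"
    by (simp add: Y_def[symmetric])
qed

section \<open>Lewis weights and the iterates of the algorithm\<close>

locale block_lewis =
  fixes A :: "real mat" and m n k :: nat and blk :: "nat \<Rightarrow> nat" and p :: real
    and v :: "nat \<Rightarrow> real"
  assumes A: "A \<in> carrier_mat m n" and full_rank: "mat_rank A = n"
    and blk_less: "j < m \<Longrightarrow> blk j < k" and p: "2 < p"
    and lewis: "is_block_lewis_weights A blk k p v"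
begin

abbreviation scaled :: "(nat \<Rightarrow> real) \<Rightarrow> real mat" where
  "scaled w \<equiv> block_scale blk (lewis_scaling p w) A"

lemma lewis_scaling_pos: "0 < w i \<Longrightarrow> 0 < lewis_scaling p w i"
  by (simp add: lewis_scaling_def)

lemma lewis_scaling_square: "(lewis_scaling p w i)\<^sup>2 = w i powr (1 - 2 / p)"
  by (simp add: lewis_scaling_def power2_eq_square powr_add[symmetric])

lemma gram_dual_scaled:
  assumes "\<And>i. i < k \<Longrightarrow> 0 < w i"
  shows "gram_dual (row A) (\<lambda>l. w (blk l) powr (1 - 2 / p)) m n (gram_inverse (scaled w))"
  using gram_dual_block_scale[OF A full_rank blk_less, where d = "lewis_scaling p w"] assms lewis_scaling_pos
  by (simp add: lewis_scaling_square)

lemma sum_leverage_scaled: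
  assumes "\<And>i. i < k \<Longrightarrow> 0 < w i"
  shows "(\<Sum>j | j < m \<and> blk j = i. leverage_score (scaled w) j) = w i powr (1 - 2 / p) *
    (\<Sum>j | j < m \<and> blk j = i. row A j \<bullet> (gram_inverse (scaled w) *\<^sub>v row A j))"
  unfolding sum_distrib_left
  by (intro sum.cong)
    (auto simp: leverage_score_block_scale[OF A gram_dual.P[OF gram_dual_scaled[OF assms]]]
      lewis_scaling_square)

text \<open>Divided by v_i^(1 - 2/p), the Lewis equation is the fixed-point assumption of the
  abstract iteration.\<close>

sublocale lewis_iteration "row A" m n k blk "1 - 2 / p" "\<lambda>w. gram_inverse (scaled w)" v
proof (rule lewis_iteration.intro)
  show vpos: "0 < v i" if "i < k" for i using lewis that unfolding is_block_lewis_weights_def by blast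
  fix i assume i: "i < k"
  have B: "scaled v \<in> carrier_mat m n" by (rule block_scale_carrier[OF A])
  have "v i = block_leverage_score (scaled v) blk i"
    using lewis i unfolding is_block_lewis_weights_def by blast
  also have "\<dots> = (\<Sum>j | j < m \<and> blk j = i. leverage_score (scaled v) j)"
    by (rule block_leverage_score_eq_sum[OF B gram_dual.P[OF gram_dual_scaled[OF vpos]]])
  also have "\<dots> = v i powr (1 - 2 / p) *
      (\<Sum>j | j < m \<and> blk j = i. row A j \<bullet> (gram_inverse (scaled v) *\<^sub>v row A j))"
    by (rule sum_leverage_scaled[OF vpos])
  finally show "v i powr (1 - (1 - 2 / p))
      = (\<Sum>j | j < m \<and> blk j = i. row A j \<bullet> (gram_inverse (scaled v) *\<^sub>v row A j))"
    using vpos[OF i] by (simp add: powr_diff field_simps)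
qed (use p blk_less gram_dual_scaled in auto)

abbreviation r :: "nat \<Rightarrow> nat" where
  "r i \<equiv> mat_rank (row_block A blk i)"

abbreviation R :: nat where
  "R \<equiv> block_rank_sum A blk k"

lemma v_le_rank:
  assumes "i < k"
  shows "v i \<le> real (r i)"
proof -
  have "v i = v i powr (1 - 2 / p) * score v i" using v_eq_iterate[OF assms] by (simp add: iterate_def)
  also have "\<dots> \<le> real (r i)"
    unfolding score_def by (rule block_leverage_le_rank[OF A gd[OF pos_v]]) auto
  finally show ?thesis .
qed

lemma R_eq: "real R = (\<Sum>i<k. real (r i))"
  by (simp add: block_rank_sum_def)

lemma n_le_R: "n \<le> R"
proof -
  have "(\<Sum>i<k. v i) \<le> (\<Sum>i<k. real (r i))" using v_le_rank by (intro sum_mono) auto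
  then show ?thesis unfolding sum_v R_eq[symmetric] by simp
qed

text \<open>The bounds \<open>v_le_rank\<close> sum to n \<le> R, so R = n forces equality in each.
  This justifies the output without iterations.\<close>

lemma v_eq_rank:
  assumes "R = n" and i: "i < k"
  shows "v i = real (r i)"
proof -
  have "(\<Sum>i<k. v i) = (\<Sum>i<k. real (r i))" using assms(1) by (simp add: sum_v R_eq[symmetric])
  then show ?thesis using i v_le_rank by (intro sum_mono_inv[of v "{..<k}"]) auto
qed

lemma n_pos: "0 < k \<Longrightarrow> 0 < n"
proof -
  assume "0 < k"
  then have "0 < (\<Sum>i<k. v i)" using v_pos by (intro sum_pos) auto
  then show "0 < n" by (simp add: sum_v)
qed

definition init :: "nat \<Rightarrow> real" where
  "init i = real n * real (r i) / real R"

text \<open>By \<open>v_le_rank\<close> each ratio \<open>v i / init i\<close> is at most R/n, so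
  the entropy is at most n ln(R/n) \<le> R - n.\<close>

lemma init:
  assumes "0 < k"
  shows "pos init" "(\<Sum>i<k. init i) = real n" "kl init \<le> real R"
proof -
  have n: "0 < n" by (rule n_pos[OF assms])
  then have R: "0 < R" using n_le_R by simp
  have r: "0 < r i" if "i < k" for i using v_le_rank[OF that] v_pos[OF that] by simp
  show "pos init" using n R r by (simp add: init_def)
  show "(\<Sum>i<k. init i) = real n"
    using R by (simp add: init_def sum_distrib_left[symmetric] sum_divide_distrib[symmetric]
        R_eq[symmetric])
  have "kl init \<le> (\<Sum>i<k. v i * ln (real R / real n))"
    unfolding kl_def
  proof (intro sum_mono mult_left_mono)
    fix i assume "i \<in> {..<k}"
    then have i: "i < k" by simp
    show "0 \<le> v i" using v_pos[OF i] by simp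
    have "v i / init i \<le> real R / real n"
      using v_le_rank[OF i] n R r[OF i] by (simp add: init_def field_simps)
    then show "ln (v i / init i) \<le> ln (real R / real n)"
      using v_pos[OF i] n R r[OF i] by (intro ln_mono) (auto simp: init_def)
  qed
  also have "\<dots> = real n * ln (real R / real n)" by (simp add: sum_distrib_right[symmetric] sum_v)
  also have "\<dots> \<le> real n * (real R / real n - 1)"
    using n R by (intro mult_left_mono ln_le_minus_one) auto
  also have "\<dots> \<le> real R" using n by (simp add: field_simps)
  finally show "kl init \<le> real R" .
qed

lemma lewis_step_eq:
  assumes "pos w"
  shows "lewis_step A blk p (u, w, hist)
    = (w, iterate w, hist @ [(lewis_scaling p w, leverage_score (scaled w))])"
proof -
  have "(\<Sum>j | j < m \<and> blk j = i. leverage_score (scaled w) j) = iterate w i" for i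
    unfolding iterate_def score_def by (rule sum_leverage_scaled) (use assms in blast)
  then show ?thesis using A by (simp add: lewis_step_def Let_def)
qed

text \<open>Stated for \<open>Suc t\<close>, since only after a step is the first component the
  predecessor of the second.\<close>

lemma funpow_lewis_step:
  assumes "0 < k"
  shows "(lewis_step A blk p ^^ Suc t) (init, init, [])
    = ((iterate ^^ t) init, (iterate ^^ Suc t) init,
       map (\<lambda>s. let w = (iterate ^^ s) init in (lewis_scaling p w, leverage_score (scaled w)))
         [0..<Suc t])"
proof (induction t)
  case 0
  then show ?case using init(1)[OF assms] by (simp add: lewis_step_eq Let_def)
next
  case (Suc t)
  have "pos ((iterate ^^ Suc t) init)" using funpow_iterate[OF init(1,2)[OF assms]] by blast
  then show ?case
    unfolding funpow.simps(2)[of "Suc t" "lewis_step A blk p"] comp_apply Suc.IH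
    by (simp add: lewis_step_eq Let_def)
qed

theorem algorithm_correct:
  assumes eps: "0 < \<epsilon>" "\<epsilon> < 1"
    and alg: "block_lewis_algorithm A blk k p \<epsilon> = (w_hat, hist)"
  shows "(\<forall>i<k. 0 < w_hat i \<and> (1 - \<epsilon>) * v i \<le> w_hat i \<and> w_hat i \<le> (1 + \<epsilon>) * v i)
    \<and> real (length hist) \<le> 5 * p * ln (p * sqrt (real R) / \<epsilon>)
    \<and> (\<forall>(d, s) \<in> set hist. (\<forall>i<k. 0 < d i) \<and>
         (\<forall>j<m. s j = leverage_score (block_scale blk d A) j))"
proof (cases "R = n")
  case True
  then have out: "w_hat = (\<lambda>i. real (r i))" "hist = []"
    using alg A by (auto simp: block_lewis_algorithm_def Let_def)
  have "0 < w_hat i \<and> (1 - \<epsilon>) * v i \<le> w_hat i \<and> w_hat i \<le> (1 + \<epsilon>) * v i" if i: "i < k" for i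
    using v_eq_rank[OF True i] v_pos[OF i] eps by (simp add: out algebra_simps)
  \<comment> \<open>The history is empty, so nonnegativity suffices; for R = 0 it rests on
    \<open>ln 0 = 0\<close>.\<close>
  moreover have "0 \<le> 5 * p * ln (p * sqrt (real R) / \<epsilon>)"
  proof (cases "R = 0")
    case False
    then show ?thesis
      using lewis_num_iterations_bounds(2)[OF p eps, of R] by linarith
  qed simp
  ultimately show ?thesis by (simp add: out)
next
  case False
  have k: "0 < k"
  proof (rule ccontr)
    assume "\<not> 0 < k"
    then show False using sum_v False by (simp add: block_rank_sum_def)
  qed
  have R: "1 \<le> R" using n_pos[OF k] n_le_R by simp
  obtain t where t: "lewis_num_iterations p \<epsilon> R = Suc t"
    using lewis_num_iterations_bounds(1)[OF p eps R] by (metis gr0_implies_Suc)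
  \<comment> \<open>The weights of index N - 1, a power of which the output divides by.\<close>
  define w where "w = (iterate ^^ t) init"
  have w: "pos w" "(\<Sum>i<k. w i) = real n" "kl w \<le> (1 - 2 / p) ^ t * kl init"
    using funpow_iterate[OF init(1,2)[OF k], of t] by (auto simp: w_def)
  have init_eq: "(\<lambda>i. real n * real (r i) / real R) = init" by (auto simp: init_def)
  have out: "w_hat = (\<lambda>i. (iterate w i / w i powr (1 - 2 / p)) powr (p / 2))"
    "hist = map (\<lambda>s. let w = (iterate ^^ s) init in (lewis_scaling p w, leverage_score (scaled w)))
         [0..<Suc t]"
    using alg A False funpow_lewis_step[OF k, of t]
    by (auto simp: block_lewis_algorithm_def Let_def t init_eq w_def)
  define d where "d = 11 / 50 * \<epsilon> / p"
  have d: "0 \<le> d" using eps p by (simp add: d_def)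
  have "0 \<le> (1 - 2 / p) ^ t" using p by simp
  then have "kl w \<le> (1 - 2 / p) ^ t * real R"
    using w(3) mult_left_mono[OF init(3)[OF k]] by (meson order_trans)
  also have "\<dots> \<le> d\<^sup>2"
    unfolding d_def by (rule contraction_after_iterations[OF p eps R t[symmetric]])
  finally have kl: "kl w \<le> d\<^sup>2" .
  define e where "e = 2 * d + d\<^sup>2"
  have e: "0 \<le> e" "e \<le> \<epsilon> / (2 * p)" "e < 1"
  proof -
    have ep: "\<epsilon> / p \<le> 1 / 2" "0 < \<epsilon> / p" using eps p by (auto simp: field_simps)
    have "d = 11 / 50 * (\<epsilon> / p)" by (simp add: d_def)
    moreover have "(\<epsilon> / p) * (\<epsilon> / p) \<le> (\<epsilon> / p) * (1 / 2)" using ep by (intro mult_left_mono) auto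
    ultimately have "e \<le> 1 / 2 * (\<epsilon> / p)" using ep unfolding e_def power2_eq_square by simp
    then show "e \<le> \<epsilon> / (2 * p)" "e < 1" using ep by (simp, linarith)
    show "0 \<le> e" using d by (simp add: e_def)
  qed
  have "0 < w_hat i \<and> (1 - \<epsilon>) * v i \<le> w_hat i \<and> w_hat i \<le> (1 + \<epsilon>) * v i" if i: "i < k" for i
  proof -
    have wi: "0 < w i" using w(1) i by blast
    \<comment> \<open>The quotient in the output cancels w_i^(1 - 2/p) and leaves the score. The
      Lewis weight is the same power of its own score, since 1 - b = 2/p.\<close>
    have hat: "w_hat i = score w i powr (p / 2)" using wi by (simp add: out iterate_def)
    have vi: "v i = score v i powr (p / 2)"
      using p v_pos[OF i] by (simp add: score_v[OF i] powr_powr)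
    note approx = score_approx[OF w(1) e(1,3) i energy_approx[OF w(1,2) d kl, folded e_def]]
    show ?thesis
      using powr_approx[OF p eps e(1,2) score_v_pos[OF i] approx] score_pos[OF w(1) i]
      unfolding hat vi by simp
  qed
  moreover have "real (length hist) \<le> 5 * p * ln (p * sqrt (real R) / \<epsilon>)"
    using lewis_num_iterations_bounds(2)[OF p eps R] by (simp add: out t)
  moreover have "\<forall>(d, s) \<in> set hist. (\<forall>i<k. 0 < d i) \<and>
      (\<forall>j<m. s j = leverage_score (block_scale blk d A) j)"
    using funpow_iterate[OF init(1,2)[OF k]] lewis_scaling_pos by (auto simp: out Let_def)
  ultimately show ?thesis by blast
qed

end

theorem theorem1p3:
  shows "\<exists>C::real. C > 0 \<and>
    (\<forall>(A :: real mat) (m :: nat) (n :: nat) (k :: nat) (blk :: nat \<Rightarrow> nat)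
      (p :: real) (\<epsilon> :: real) (w_bar :: nat \<Rightarrow> real) (w_hat :: nat \<Rightarrow> real) (hist :: lewis_history).
        A \<in> carrier_mat m n \<longrightarrow>
        mat_rank A = n \<longrightarrow>
        (\<forall>j<m. blk j < k) \<longrightarrow>
        (\<forall>i<k. row_block A blk i \<noteq> 0\<^sub>m (dim_row (row_block A blk i)) n) \<longrightarrow>
        p > 2 \<longrightarrow>
        is_block_lewis_weights A blk k p w_bar \<longrightarrow>
        0 < \<epsilon> \<longrightarrow> \<epsilon> < 1 \<longrightarrow>
        block_lewis_algorithm A blk k p \<epsilon> = (w_hat, hist) \<longrightarrow>
          (\<forall>i<k. 0 < w_hat i \<and>
                 (1 - \<epsilon>) * w_bar i \<le> w_hat i \<and> w_hat i \<le> (1 + \<epsilon>) * w_bar i) \<and>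
          real (length hist)
            \<le> C * p * ln (p * sqrt (\<Sum>i<k. real (mat_rank (row_block A blk i))) / \<epsilon>) \<and>
          (\<forall>(d, s) \<in> set hist.
             (\<forall>i<k. 0 < d i) \<and>
             (\<forall>j<m. s j = leverage_score (block_scale blk d A) j)))"
\<comment> \<open>The constant 5 comes from \<open>lewis_num_iterations_bounds\<close>.\<close>
proof (intro exI[of _ 5] conjI[of "0 < (5::real)"] allI impI)
  fix A m n k blk p \<epsilon> w_bar w_hat hist
  assume "A \<in> carrier_mat m n" "mat_rank A = n" "\<forall>j<m. blk j < k" "p > 2"
    "is_block_lewis_weights A blk k p w_bar"
  then interpret block_lewis A m n k blk p w_bar by unfold_locales auto
  assume "0 < \<epsilon>" "\<epsilon> < 1" "block_lewis_algorithm A blk k p \<epsilon> = (w_hat, hist)"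
  from algorithm_correct[OF this]
  show "(\<forall>i<k. 0 < w_hat i \<and>
                 (1 - \<epsilon>) * w_bar i \<le> w_hat i \<and> w_hat i \<le> (1 + \<epsilon>) * w_bar i) \<and>
          real (length hist)
            \<le> 5 * p * ln (p * sqrt (\<Sum>i<k. real (mat_rank (row_block A blk i))) / \<epsilon>) \<and>
          (\<forall>(d, s) \<in> set hist.
             (\<forall>i<k. 0 < d i) \<and>
             (\<forall>j<m. s j = leverage_score (block_scale blk d A) j))"
    unfolding R_eq .
qed simp

end
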